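(* For every $C>0$ there exists $C_1=C_1(C)>0$ (depending only on $C$, not on the dimension $n$ or on $f$) such that the following holds: if $f\in \mathrm{LC}_g(\mathbb{R}^n)$ is in covering-$M$-position with constant $C$ then it is in volume-$M$-position with constant $C_1$, and if $f\in \mathrm{LC}_g(\mathbb{R}^n)$ is in volume-$M$-position with constant $C$ then it is in covering-$M$-position with constant $C_1$.
   Context: $\mathrm{LC}_g(\mathbb{R}^n)$ is the class of geometric log-concave functions: upper semi-continuous $f:\mathbb{R}^n\to[0,1]$ with $-\log f$ convex (values in $[0,\infty]$), $\max f=f(0)=1$, and $0<\int f<\infty$. $g_0(x)=\exp(-|x|^2/2)$. For $f=e^{-\varphi}$, $f^*=e^{-\mathcal{L}\varphi}$ with $\mathcal{L}\varphi(y)=\sup_{x}(\langle y,x\rangle-\varphi(x))$. $(f\star h)(x)=\sup_{z} f(z)h(x-z)$. The functional covering number is $N(f,g)=\inf\{\mu(\mathbb{R}^n)\}$ over all non-negative Borel measures $\mu$ on $\mathbb{R}^n$ such that $(\mu*g)(x)=\int g(x-t)\,d\mu(t)\ge f(x)$ for all $x$. Volume-$M$-position: $f\in \mathrm{LC}_g(\mathbb{R}^n)$ is in volume-$M$-position with constant $C$ if $\int f=(2\pi)^{n/2}$ and for every $h\in \mathrm{LC}_g(\mathbb{R}^n)$ $$C^{-n}\int g_0\star h\le\int f\star h\le C^n\int g_0\star h\quad\text{and}\quad C^{-n}\int g_0\star h\le\int f^*\star h\le C^n\int g_0\star h.$$ Covering-$M$-position: $f\in \mathrm{LC}_g(\mathbb{R}^n)$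 is in covering-$M$-position with constant $C$ if $\int f=(2\pi)^{n/2}$ and each of $N(f,g_0),N(g_0,f),N(f^*,g_0),N(g_0,f^* )$ is at most $C^n$. *)

theory Defs
  imports "HOL-Analysis.Analysis"
begin

text \<open>
  The dimension \<open>n\<close> has to be quantified inside the formula (the constant must not depend on it), so
  \<open>\<real>\<^sup>n\<close> is the set of extensional functions \<open>{..<n} \<rightarrow>\<^sub>E UNIV\<close> rather than a type. This is the
  carrier both of \<open>product_topology (\<lambda>_. euclideanreal) {..<n}\<close> and of
  \<open>PiM {..<n} (\<lambda>_. lborel)\<close>. A function on \<open>\<real>\<^sup>n\<close> has type \<open>(nat \<Rightarrow> real) \<Rightarrow> real\<close>; its values
  off the carrier are never used.
\<close>

definition Rn :: "nat \<Rightarrow> (nat \<Rightarrow> real) set" where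
  "Rn n = {..<n} \<rightarrow>\<^sub>E UNIV"

definition Rn_topology :: "nat \<Rightarrow> (nat \<Rightarrow> real) topology" where
  "Rn_topology n = product_topology (\<lambda>_. euclideanreal) {..<n}"

definition Rn_lebesgue :: "nat \<Rightarrow> (nat \<Rightarrow> real) measure" where
  "Rn_lebesgue n = (\<Pi>\<^sub>M i\<in>{..<n}. lborel)"

definition Rn_zero :: "nat \<Rightarrow> nat \<Rightarrow> real" where
  "Rn_zero n = (\<lambda>i\<in>{..<n}. 0)"

definition Rn_diff :: "nat \<Rightarrow> (nat \<Rightarrow> real) \<Rightarrow> (nat \<Rightarrow> real) \<Rightarrow> nat \<Rightarrow> real" where
  "Rn_diff n x y = (\<lambda>i\<in>{..<n}. x i - y i)"

definition Rn_comb :: "nat \<Rightarrow> real \<Rightarrow> (nat \<Rightarrow> real) \<Rightarrow> (nat \<Rightarrow> real) \<Rightarrow> nat \<Rightarrow> real" where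
  "Rn_comb n t x y = (\<lambda>i\<in>{..<n}. (1 - t) * x i + t * y i)"

definition Rn_inner :: "nat \<Rightarrow> (nat \<Rightarrow> real) \<Rightarrow> (nat \<Rightarrow> real) \<Rightarrow> real" where
  "Rn_inner n x y = (\<Sum>i<n. x i * y i)"

definition Rn_integral :: "nat \<Rightarrow> ((nat \<Rightarrow> real) \<Rightarrow> real) \<Rightarrow> ennreal" where
  "Rn_integral n f = (\<integral>\<^sup>+ x. ennreal (f x) \<partial>Rn_lebesgue n)"

text \<open>\<open>-log\<close> on \<open>[0, \<infinity>)\<close> and \<open>exp (- _)\<close>, with \<open>-log 0 = \<infinity>\<close> and \<open>exp (-\<infinity>) = 0\<close>.
  The value of \<open>exp_neg\<close> at \<open>-\<infinity>\<close> is arbitrary: for \<open>f 0 = 1\<close> the Legendre transform of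
  \<open>-log f\<close> is nonnegative.\<close>

definition neg_log :: "real \<Rightarrow> ereal" where
  "neg_log t = (if t = 0 then \<infinity> else ereal (- ln t))"

definition exp_neg :: "ereal \<Rightarrow> real" where
  "exp_neg u = (case u of ereal r \<Rightarrow> exp (- r) | PInfty \<Rightarrow> 0 | MInfty \<Rightarrow> 0)"

definition usc_on_Rn :: "nat \<Rightarrow> ((nat \<Rightarrow> real) \<Rightarrow> real) \<Rightarrow> bool" where
  "usc_on_Rn n f \<longleftrightarrow> (\<forall>a. openin (Rn_topology n) {x \<in> Rn n. f x < a})"

definition convex_on_Rn :: "nat \<Rightarrow> ((nat \<Rightarrow> real) \<Rightarrow> ereal) \<Rightarrow> bool" where
  "convex_on_Rn n \<phi> \<longleftrightarrow>
    (\<forall>x\<in>Rn n. \<forall>y\<in>Rn n. \<forall>t\<in>{0..1}.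
       \<phi> (Rn_comb n t x y) \<le> ereal (1 - t) * \<phi> x + ereal t * \<phi> y)"

text \<open>\<open>max f = f 0 = 1\<close> is the conjunction of \<open>f \<le> 1\<close> and \<open>f 0 = 1\<close>.\<close>

definition LCg :: "nat \<Rightarrow> ((nat \<Rightarrow> real) \<Rightarrow> real) set" where
  "LCg n = {f. (\<forall>x\<in>Rn n. 0 \<le> f x \<and> f x \<le> 1) \<and>
               usc_on_Rn n f \<and>
               convex_on_Rn n (\<lambda>x. neg_log (f x)) \<and>
               f (Rn_zero n) = 1 \<and>
               0 < Rn_integral n f \<and> Rn_integral n f < \<infinity>}"

definition gaussian :: "nat \<Rightarrow> (nat \<Rightarrow> real) \<Rightarrow> real" where
  "gaussian n x = exp (- Rn_inner n x x / 2)"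

definition legendre :: "nat \<Rightarrow> ((nat \<Rightarrow> real) \<Rightarrow> ereal) \<Rightarrow> (nat \<Rightarrow> real) \<Rightarrow> ereal" where
  "legendre n \<phi> y = (SUP x\<in>Rn n. ereal (Rn_inner n y x) - \<phi> x)"

definition dual_fun :: "nat \<Rightarrow> ((nat \<Rightarrow> real) \<Rightarrow> real) \<Rightarrow> (nat \<Rightarrow> real) \<Rightarrow> real" where
  "dual_fun n f y = exp_neg (legendre n (\<lambda>x. neg_log (f x)) y)"

text \<open>The supremum is a real one; it is used only for functions with values in \<open>[0, 1]\<close>.\<close>

definition sup_conv ::
    "nat \<Rightarrow> ((nat \<Rightarrow> real) \<Rightarrow> real) \<Rightarrow> ((nat \<Rightarrow> real) \<Rightarrow> real) \<Rightarrow> (nat \<Rightarrow> real) \<Rightarrow> real" where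
  "sup_conv n f h x = (SUP z\<in>Rn n. f z * h (Rn_diff n x z))"

text \<open>The product sigma-algebra is the Borel sigma-algebra of \<open>\<real>\<^sup>n\<close>; no finiteness is imposed on \<open>\<mu>\<close>.\<close>

definition covering_measures ::
    "nat \<Rightarrow> ((nat \<Rightarrow> real) \<Rightarrow> real) \<Rightarrow> ((nat \<Rightarrow> real) \<Rightarrow> real) \<Rightarrow> (nat \<Rightarrow> real) measure set" where
  "covering_measures n f g =
    {\<mu>. sets \<mu> = sets (\<Pi>\<^sub>M i\<in>{..<n}. (borel :: real measure)) \<and>
        (\<forall>x\<in>Rn n. ennreal (f x) \<le> (\<integral>\<^sup>+ t. ennreal (g (Rn_diff n x t)) \<partial>\<mu>))}"

definition covering_number ::
    "nat \<Rightarrow> ((nat \<Rightarrow> real) \<Rightarrow> real) \<Rightarrow> ((nat \<Rightarrow> real) \<Rightarrow> real) \<Rightarrow> ennreal" where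
  "covering_number n f g = (INF \<mu>\<in>covering_measures n f g. emeasure \<mu> (Rn n))"

definition volume_M_position :: "nat \<Rightarrow> real \<Rightarrow> ((nat \<Rightarrow> real) \<Rightarrow> real) \<Rightarrow> bool" where
  "volume_M_position n C f \<longleftrightarrow>
    Rn_integral n f = ennreal ((2 * pi) powr (real n / 2)) \<and>
    (\<forall>h\<in>LCg n.
       ennreal (C powi (- int n)) * Rn_integral n (sup_conv n (gaussian n) h)
         \<le> Rn_integral n (sup_conv n f h) \<and>
       Rn_integral n (sup_conv n f h)
         \<le> ennreal (C ^ n) * Rn_integral n (sup_conv n (gaussian n) h) \<and>
       ennreal (C powi (- int n)) * Rn_integral n (sup_conv n (gaussian n) h)
         \<le> Rn_integral n (sup_conv n (dual_fun n f) h) \<and>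
       Rn_integral n (sup_conv n (dual_fun n f) h)
         \<le> ennreal (C ^ n) * Rn_integral n (sup_conv n (gaussian n) h))"

definition covering_M_position :: "nat \<Rightarrow> real \<Rightarrow> ((nat \<Rightarrow> real) \<Rightarrow> real) \<Rightarrow> bool" where
  "covering_M_position n C f \<longleftrightarrow>
    Rn_integral n f = ennreal ((2 * pi) powr (real n / 2)) \<and>
    covering_number n f (gaussian n) \<le> ennreal (C ^ n) \<and>
    covering_number n (gaussian n) f \<le> ennreal (C ^ n) \<and>
    covering_number n (dual_fun n f) (gaussian n) \<le> ennreal (C ^ n) \<and>
    covering_number n (gaussian n) (dual_fun n f) \<le> ennreal (C ^ n)"

end

theory Submission
  imports Defs "HOL-Probability.Distributions"
begin

text \<open>
  If \<open>\<mu>\<close> covers \<open>f\<close> by \<open>g\<close>, i.e. \<open>f \<le> \<mu> * g\<close>, then pointwise \<open>f \<star> h \<le> \<mu> * (g \<star> h)\<close>, and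
  Tonelli gives \<open>\<integral>f \<star> h \<le> \<mu>(\<real>\<^sup>n) \<integral>g \<star> h\<close>; so bounds on covering numbers give bounds on
  volumes. Conversely, writing \<open>g'(x) = g(-x)\<close>, the measure with density \<open>f \<star> g'\<close>, divided by
  \<open>\<integral>g\<^sup>2\<close>, covers \<open>f\<close> by \<open>g\<close>, whence \<open>N(f, g) \<le> \<integral>f \<star> g' / \<integral>g\<^sup>2\<close>. Log-concavity enters only
  through \<open>f(x) \<le> f(x/2)\<^sup>2\<close>, which bounds \<open>\<integral>f\<^sup>2\<close> below by \<open>2\<^sup>-\<^sup>n \<integral>f\<close>, and in the same way for the
  dual of \<open>f\<close>. The integral of the dual is bounded below by testing the volume inequality on Gaussians
  that shrink to the indicator of the origin.
\<close>

subsection \<open>Measurability of sup-convolutions\<close>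

lemma Rn_diff_in [simp]: "Rn_diff n x y \<in> Rn n"
  by (simp add: Rn_diff_def Rn_def)

lemma Rn_zero_in [simp]: "Rn_zero n \<in> Rn n"
  by (simp add: Rn_zero_def Rn_def)

lemma Rn_eqI: "x \<in> Rn n \<Longrightarrow> y \<in> Rn n \<Longrightarrow> (\<And>i. i < n \<Longrightarrow> x i = y i) \<Longrightarrow> x = y"
  unfolding Rn_def by (rule PiE_ext) auto

lemma space_Rn_lebesgue [simp]: "space (Rn_lebesgue n) = Rn n"
  by (simp add: Rn_lebesgue_def space_PiM Rn_def)

lemma space_PiM_borel [simp]: "space (\<Pi>\<^sub>M i\<in>{..<n}. (borel :: real measure)) = Rn n"
  by (simp add: space_PiM Rn_def)

lemma sets_Rn_lebesgue [measurable_cong]: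
  "sets (Rn_lebesgue n) = sets (\<Pi>\<^sub>M i\<in>{..<n}. (borel :: real measure))"
  unfolding Rn_lebesgue_def by (intro sets_PiM_cong) auto

lemma measurable_Rn_diff [measurable]:
  assumes [measurable]: "f \<in> M \<rightarrow>\<^sub>M (\<Pi>\<^sub>M i\<in>{..<n}. (borel :: real measure))"
    "g \<in> M \<rightarrow>\<^sub>M (\<Pi>\<^sub>M i\<in>{..<n}. (borel :: real measure))"
  shows "(\<lambda>x. Rn_diff n (f x) (g x)) \<in> M \<rightarrow>\<^sub>M (\<Pi>\<^sub>M i\<in>{..<n}. (borel :: real measure))"
  unfolding Rn_diff_def
  by (intro measurable_restrict borel_measurable_diff
      measurable_compose[OF assms(1) measurable_component_singleton]
      measurable_compose[OF assms(2) measurable_component_singleton]) auto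

text \<open>Closedness refers to the space of all functions \<open>nat \<Rightarrow> real\<close>,
  whose Borel sets form the full product sigma-algebra. The inclusion of \<open>Rn n\<close> is
  measurable because every coordinate from \<open>n\<close> on is the constant
  \<open>undefined\<close>.\<close>

lemma closed_imp_measurable_Rn:
  assumes "closed (S :: (nat \<Rightarrow> real) set)"
  shows "S \<inter> Rn n \<in> sets (\<Pi>\<^sub>M i\<in>{..<n}. (borel :: real measure))"
proof -
  have "(\<lambda>x. x) \<in> (\<Pi>\<^sub>M i\<in>{..<n}. (borel :: real measure)) \<rightarrow>\<^sub>M (\<Pi>\<^sub>M i\<in>UNIV. (borel :: real measure))"
  proof (rule measurable_PiM_single')
    fix i :: nat
    show "(\<lambda>x. x i) \<in> (\<Pi>\<^sub>M i\<in>{..<n}. (borel :: real measure)) \<rightarrow>\<^sub>M borel"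
    proof (cases "i < n")
      case True
      then show ?thesis by simp
    next
      case False
      then have "\<And>x. x \<in> space (\<Pi>\<^sub>M i\<in>{..<n}. (borel :: real measure)) \<Longrightarrow> x i = undefined"
        by (auto simp: Rn_def PiE_def extensional_def)
      then show ?thesis by (subst measurable_cong[where g = "\<lambda>_. undefined"]) auto
    qed
  qed (auto simp: Rn_def)
  moreover have "S \<in> sets (\<Pi>\<^sub>M i\<in>UNIV. (borel :: real measure))"
    using assms by (simp add: sets_PiM_equal_borel)
  ultimately have "(\<lambda>x. x) -` S \<inter> Rn n \<in> sets (\<Pi>\<^sub>M i\<in>{..<n}. (borel :: real measure))"
    by (metis measurable_sets space_PiM_borel)
  then show ?thesis by simp
qed

text \<open>Restriction to the first \<open>n\<close> coordinates is continuous on the whole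
  function space and fixes \<open>Rn n\<close>, so the preimage of \<open>U\<close> serves as
  \<open>V\<close>. This moves questions about \<open>Rn_topology\<close> to the type class
  topology.\<close>

lemma openin_Rn_topologyD:
  assumes "openin (Rn_topology n) U"
  shows "\<exists>V. open V \<and> U = V \<inter> Rn n"
proof -
  have "continuous_map euclidean (Rn_topology n) (\<lambda>x. restrict x {..<n})"
    unfolding Rn_topology_def continuous_map_componentwise
  proof (intro conjI ballI)
    fix i assume "i \<in> {..<n}"
    then have "(\<lambda>x. restrict x {..<n} i) = (\<lambda>x. x i :: real)" by auto
    then show "continuous_map euclidean euclideanreal (\<lambda>x. restrict x {..<n} i)"
      using continuous_on_product_coordinates by (simp add: continuous_map_iff_continuous2)
  qed auto
  from openin_continuous_map_preimage[OF this assms]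
  have "open {x. restrict x {..<n} \<in> U}" by simp
  moreover have "U \<subseteq> Rn n"
    using openin_subset[OF assms] by (simp add: Rn_topology_def Rn_def)
  then have "U = {x. restrict x {..<n} \<in> U} \<inter> Rn n"
    by (auto simp: Rn_def PiE_def extensional_restrict)
  ultimately show ?thesis by blast
qed

lemma usc_on_Rn_closed:
  assumes "usc_on_Rn n f"
  shows "\<exists>S. closed S \<and> {x \<in> Rn n. f x \<ge> a} = S \<inter> Rn n"
proof -
  obtain V where V: "open V" "{x \<in> Rn n. f x < a} = V \<inter> Rn n"
    using assms openin_Rn_topologyD unfolding usc_on_Rn_def by blast
  then have "closed (- V)" "{x \<in> Rn n. f x \<ge> a} = - V \<inter> Rn n"
    by (auto simp: set_eq_iff not_less[symmetric])
  then show ?thesis by blast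
qed

lemma borel_measurable_usc:
  assumes "usc_on_Rn n f"
  shows "f \<in> borel_measurable (\<Pi>\<^sub>M i\<in>{..<n}. (borel :: real measure))"
  unfolding borel_measurable_iff_ge space_PiM_borel
proof
  fix a
  obtain S where "closed S" "{x \<in> Rn n. a \<le> f x} = S \<inter> Rn n"
    using usc_on_Rn_closed[OF assms] by blast
  then show "{x \<in> Rn n. a \<le> f x} \<in> sets (\<Pi>\<^sub>M i\<in>{..<n}. borel)"
    using closed_imp_measurable_Rn by simp
qed

text \<open>The regularity shared by members of \<open>LCg\<close>, their duals and their
  reflections; it suffices for Borel measurability and for well-behaved real suprema in
  \<open>sup_conv\<close>.\<close>

definition unit_usc :: "nat \<Rightarrow> ((nat \<Rightarrow> real) \<Rightarrow> real) \<Rightarrow> bool" where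
  "unit_usc n f \<longleftrightarrow> (\<forall>x\<in>Rn n. 0 \<le> f x \<and> f x \<le> 1) \<and> usc_on_Rn n f"

lemma unit_uscD:
  assumes "unit_usc n f"
  shows "x \<in> Rn n \<Longrightarrow> 0 \<le> f x" "x \<in> Rn n \<Longrightarrow> f x \<le> 1" "usc_on_Rn n f"
    "f \<in> borel_measurable (\<Pi>\<^sub>M i\<in>{..<n}. (borel :: real measure))"
  using assms by (auto simp: unit_usc_def borel_measurable_usc)

lemma LCg_unit_usc: "f \<in> LCg n \<Longrightarrow> unit_usc n f"
  by (simp add: LCg_def unit_usc_def)

section \<open>Elementary bounds on sup-convolutions\<close>

lemma sup_conv_term_bounds:
  assumes "unit_usc n f" "unit_usc n h" "z \<in> Rn n"
  shows "0 \<le> f z * h (Rn_diff n x z)" "f z * h (Rn_diff n x z) \<le> 1"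
  using unit_uscD[OF assms(1)] unit_uscD[OF assms(2)] assms(3)
  by (auto intro!: mult_nonneg_nonneg mult_le_one)

lemma sup_conv_upper:
  assumes "unit_usc n f" "unit_usc n h" "z \<in> Rn n"
  shows "f z * h (Rn_diff n x z) \<le> sup_conv n f h x"
  unfolding sup_conv_def
  by (rule cSUP_upper[OF assms(3)], rule bdd_aboveI2[where M = 1])
     (rule sup_conv_term_bounds[OF assms(1,2)])

lemma sup_conv_least:
  assumes "\<And>z. z \<in> Rn n \<Longrightarrow> f z * h (Rn_diff n x z) \<le> a"
  shows "sup_conv n f h x \<le> a"
  unfolding sup_conv_def
proof (rule cSUP_least)
  show "Rn n \<noteq> {}" using Rn_zero_in by (metis empty_iff)
qed (rule assms)

lemma less_sup_conv_iff:
  assumes "unit_usc n f" "unit_usc n h"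
  shows "a < sup_conv n f h x \<longleftrightarrow> (\<exists>z\<in>Rn n. a < f z * h (Rn_diff n x z))"
proof
  assume "a < sup_conv n f h x"
  then show "\<exists>z\<in>Rn n. a < f z * h (Rn_diff n x z)"
    using sup_conv_least[of n f h x a] by (meson not_less)
next
  assume "\<exists>z\<in>Rn n. a < f z * h (Rn_diff n x z)"
  then show "a < sup_conv n f h x"
    using sup_conv_upper[OF assms] by (blast intro: less_le_trans)
qed

lemma ennreal_sup_conv_least:
  assumes "unit_usc n f" "unit_usc n h"
    and le: "\<And>z. z \<in> Rn n \<Longrightarrow> ennreal (f z * h (Rn_diff n x z)) \<le> B"
  shows "ennreal (sup_conv n f h x) \<le> B"
proof (cases B)
  case (real b)
  then have "sup_conv n f h x \<le> b"
    using le by (intro sup_conv_least) (simp add: ennreal_le_iff)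
  with real show ?thesis by (simp add: ennreal_leI)
qed simp

lemma sup_conv_ge_left:
  assumes "unit_usc n f" "unit_usc n h" "h (Rn_zero n) = 1" "x \<in> Rn n"
  shows "f x \<le> sup_conv n f h x"
proof -
  have "Rn_diff n x x = Rn_zero n" by (auto simp: Rn_diff_def Rn_zero_def)
  then show ?thesis using sup_conv_upper[OF assms(1,2,4), of x] assms(3) by simp
qed

section \<open>Compact boxes and closed superlevel sets\<close>

lemma closed_Rn: "closed (Rn n)"
proof -
  have "Rn n = (\<Inter>i\<in>{n..}. {x. x i = undefined})"
    by (auto simp: Rn_def PiE_def extensional_def)
  also have "closed \<dots>"
    by (intro closed_INT ballI closed_Collect_eq continuous_on_product_coordinates continuous_on_const)
  finally show ?thesis .
qed

text \<open>With the singleton of \<open>undefined\<close> as factor at every index from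
  \<open>n\<close> on, the box is a full product of compact sets, and Tychonoff's theorem
  applies.\<close>

lemma compact_Rn_box: "compact (\<Pi>\<^sub>E i\<in>{..<n :: nat}. {- m..m :: real})"
proof -
  have "(\<Pi>\<^sub>E i\<in>{..<n}. {- m..m}) = (\<Pi>\<^sub>E i\<in>UNIV. if i < n then {- m..m} else {undefined :: real})"
    by (force simp: PiE_def Pi_def extensional_def split: if_splits)
  moreover have "compactin (product_topology (\<lambda>i::nat. euclideanreal) UNIV)
      (\<Pi>\<^sub>E i\<in>UNIV. if i < n then {- m..m} else {undefined :: real})"
    by (subst compactin_PiE) auto
  ultimately show ?thesis by (simp add: euclidean_product_topology)
qed

lemma Rn_eq_Union_box: "Rn n = (\<Union>m::nat. \<Pi>\<^sub>E i\<in>{..<n}. {- real m..real m})"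
proof -
  have "x \<in> (\<Union>m::nat. \<Pi>\<^sub>E i\<in>{..<n}. {- real m..real m})" if "x \<in> Rn n" for x
  proof -
    obtain m :: nat where m: "(\<Sum>i<n. \<bar>x i\<bar>) \<le> real m" using real_arch_simple by blast
    have "\<bar>x i\<bar> \<le> real m" if "i < n" for i
      using member_le_sum[of i "{..<n}" "\<lambda>i. \<bar>x i\<bar>"] that m by auto
    then show ?thesis using that by (force simp: Rn_def PiE_def Pi_def abs_le_iff)
  qed
  then show ?thesis by (auto simp: Rn_def)
qed

text \<open>Inside \<open>Rn n \<times> Rn n\<close> the complement is the union of the relatively
  open rectangles where f < \<alpha> and h < \<beta>, taken over positive \<alpha>, \<beta> with
  \<alpha> * \<beta> \<le> b.\<close>

lemma closed_product_level:
  assumes "unit_usc n f" "unit_usc n h"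
  shows "closed {p \<in> Rn n \<times> Rn n. b \<le> f (fst p) * h (snd p)}"
proof -
  have *: "\<exists>V. open V \<and> {x \<in> Rn n. k x < a} = V \<inter> Rn n" if "unit_usc n k" for k a
    using that openin_Rn_topologyD unfolding unit_usc_def usc_on_Rn_def by blast
  obtain V where V: "\<And>a. open (V a)" "\<And>a. {x \<in> Rn n. f x < a} = V a \<inter> Rn n"
    using *[OF assms(1)] by metis
  obtain W where W: "\<And>a. open (W a)" "\<And>a. {x \<in> Rn n. h x < a} = W a \<inter> Rn n"
    using *[OF assms(2)] by metis
  define U where "U = (\<Union>(\<alpha>, \<beta>)\<in>{(\<alpha>, \<beta>). 0 < \<alpha> \<and> 0 < \<beta> \<and> \<alpha> * \<beta> \<le> b}. V \<alpha> \<times> W \<beta>)"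
  have "open U" unfolding U_def using V W by (auto intro!: open_Times)
  have "f z * h w < b \<longleftrightarrow> (z, w) \<in> U" if "z \<in> Rn n" "w \<in> Rn n" for z w
  proof -
    have fh: "0 \<le> f z" "f z \<le> 1" "0 \<le> h w" "h w \<le> 1"
      using unit_uscD[OF assms(1)] unit_uscD[OF assms(2)] that by auto
    have vw: "z \<in> V a \<longleftrightarrow> f z < a" "w \<in> W a \<longleftrightarrow> h w < a" for a using V(2) W(2) that by blast+
    show ?thesis
    proof
      assume l: "f z * h w < b"
      \<comment> \<open>Since \<open>f z\<close>, \<open>h w\<close> and \<open>e\<close> are at
        most 1, raising both factors by \<open>e\<close> raises the product by at most
        \<open>3 * e\<close>, which fits into the gap below \<open>b\<close>.\<close>
      define e where "e = min 1 ((b - f z * h w) / 3)"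
      have e: "0 < e" "e \<le> 1" using l by (auto simp: e_def)
      have "e \<le> (b - f z * h w) / 3" unfolding e_def by (rule min.cobounded2)
      then have "3 * e \<le> b - f z * h w" by (simp add: le_divide_eq mult.commute)
      then have e3: "f z * h w + 3 * e \<le> b" by (simp add: le_diff_eq add.commute)
      have "(f z + e) * (h w + e) = f z * h w + e * f z + e * h w + e * e" by algebra
      also have "\<dots> \<le> f z * h w + e * 1 + e * 1 + e * 1"
        using fh e by (intro add_mono mult_left_mono) auto
      finally have "(f z + e) * (h w + e) \<le> b" using e3 by simp
      then show "(z, w) \<in> U" unfolding U_def using fh e vw
        by (intro UN_I[of "(f z + e, h w + e)"]) auto
    next
      assume "(z, w) \<in> U"
      then obtain \<alpha> \<beta> where "0 < \<alpha>" "0 < \<beta>" "\<alpha> * \<beta> \<le> b" "f z < \<alpha>" "h w < \<beta>"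
        unfolding U_def using vw by auto
      with fh have "f z * h w < \<alpha> * \<beta>" by (intro mult_strict_mono') auto
      with \<open>\<alpha> * \<beta> \<le> b\<close> show "f z * h w < b" by simp
    qed
  qed
  then have "{p \<in> Rn n \<times> Rn n. b \<le> f (fst p) * h (snd p)} = (Rn n \<times> Rn n) - U"
    by (force simp: not_less[symmetric])
  then show ?thesis using \<open>open U\<close> by (simp add: closed_Diff closed_Times closed_Rn)
qed

text \<open>A superlevel set of \<open>f \<star> h\<close> is the image under addition of a countable union of
  compact sets; this makes \<open>f \<star> h\<close> Borel although the supremum is uncountable.\<close>

lemma borel_measurable_sup_conv:
  assumes f: "unit_usc n f" and h: "unit_usc n h"
  shows "sup_conv n f h \<in> borel_measurable (\<Pi>\<^sub>M i\<in>{..<n}. (borel :: real measure))"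
  unfolding borel_measurable_iff_greater space_PiM_borel
proof
  fix a
  define B where "B m = (\<Pi>\<^sub>E i\<in>{..<n}. {- real m..real m})" for m
  \<comment> \<open>The strict level \<open>a\<close> is exhausted by the closed levels
    \<open>a + 1 / real (Suc k)\<close>; intersecting with boxes makes each piece compact, so its
    image under the continuous map \<open>add\<close> is closed.\<close>
  define K where "K k m = {p \<in> B m \<times> B m. a + 1 / real (Suc k) \<le> f (fst p) * h (snd p)}" for k m
  define add where "add p = (\<lambda>i. if i < n then fst p i + snd p i else undefined)"
    for p :: "(nat \<Rightarrow> real) \<times> (nat \<Rightarrow> real)"
  have BR: "B m \<subseteq> Rn n" for m by (auto simp: B_def Rn_def)
  have "K k m = (B m \<times> B m) \<inter> {p \<in> Rn n \<times> Rn n. a + 1 / real (Suc k) \<le> f (fst p) * h (snd p)}"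
    for k m using BR[of m] by (auto simp: K_def)
  moreover have "compact (B m \<times> B m)" for m
    unfolding B_def by (intro compact_Times compact_Rn_box)
  ultimately have "compact (K k m)" for k m
    using closed_product_level[OF f h] by (simp add: compact_Int_closed)
  moreover have "continuous_on S add" for S
  proof (rule continuous_on_coordinatewise_then_product)
    fix i show "continuous_on S (\<lambda>x. add x i)"
    proof (cases "i < n")
      case True
      then show ?thesis unfolding add_def
        by (simp, intro continuous_on_add
            continuous_on_product_then_coordinatewise[OF continuous_on_fst[OF continuous_on_id]]
            continuous_on_product_then_coordinatewise[OF continuous_on_snd[OF continuous_on_id]])
    qed (simp add: add_def continuous_on_const)
  qed
  ultimately have closed: "closed (add ` K k m)" for k m
    by (intro compact_imp_closed compact_continuous_image)
  have "{x \<in> Rn n. a < sup_conv n f h x} = (\<Union>k. \<Union>m. add ` K k m \<inter> Rn n)"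
  proof (intro equalityI subsetI)
    fix x assume "x \<in> {x \<in> Rn n. a < sup_conv n f h x}"
    then obtain z where x: "x \<in> Rn n" and z: "z \<in> Rn n" "a < f z * h (Rn_diff n x z)"
      using less_sup_conv_iff[OF f h] by auto
    obtain k where k: "inverse (real (Suc k)) < f z * h (Rn_diff n x z) - a"
      using z reals_Archimedean by (metis diff_gt_0_iff_gt)
    obtain m1 m2 where m: "z \<in> B m1" "Rn_diff n x z \<in> B m2"
      using z(1) Rn_diff_in[of n x z] unfolding Rn_eq_Union_box B_def by blast
    have mono: "B i \<subseteq> B (max i j)" "B j \<subseteq> B (max i j)" for i j
      unfolding B_def by (intro PiE_mono; force)+
    have "(z, Rn_diff n x z) \<in> K k (max m1 m2)"
      unfolding K_def using subsetD[OF mono(1)[of m1 m2] m(1)] subsetD[OF mono(2)[of m2 m1] m(2)] k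
      by (simp add: inverse_eq_divide)
    moreover have "add (z, Rn_diff n x z) = x"
      using x by (auto simp: add_def Rn_diff_def Rn_def PiE_def extensional_def fun_eq_iff)
    ultimately show "x \<in> (\<Union>k. \<Union>m. add ` K k m \<inter> Rn n)" using x by force
  next
    fix x assume "x \<in> (\<Union>k. \<Union>m. add ` K k m \<inter> Rn n)"
    then obtain k m z w where x: "x \<in> Rn n" "x = add (z, w)" and K: "(z, w) \<in> K k m" by auto
    then have zw: "z \<in> Rn n" "w \<in> Rn n" using BR[of m] by (auto simp: K_def)
    then have "w = Rn_diff n x z"
      by (intro Rn_eqI[OF zw(2) Rn_diff_in]) (auto simp: x(2) add_def Rn_diff_def)
    moreover have "a < f z * h w" using K by (auto simp: K_def) (smt (verit) of_nat_0_le_iff zero_less_divide_1_iff)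
    ultimately show "x \<in> {x \<in> Rn n. a < sup_conv n f h x}"
      using less_sup_conv_iff[OF f h] zw x(1) by auto
  qed
  also have "\<dots> \<in> sets (\<Pi>\<^sub>M i\<in>{..<n}. (borel :: real measure))"
    using closed_imp_measurable_Rn[OF closed] by (intro sets.countable_UN image_subsetI) auto
  finally show "{x \<in> Rn n. a < sup_conv n f h x} \<in> sets (\<Pi>\<^sub>M i\<in>{..<n}. (borel :: real measure))" .
qed

text \<open>The image of Lebesgue measure under the affine map, scaled by |c|^n, gives each box its
  usual volume by the one-dimensional formula in every coordinate, so it is the product measure. The
  values 1, -1 and 1/2 of \<open>c\<close> yield translation, reflection and halving.\<close>

lemma nn_integral_Rn_affine:
  assumes F: "F \<in> borel_measurable (\<Pi>\<^sub>M i\<in>{..<n}. (borel :: real measure))" and c: "c \<noteq> 0"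
  shows "(\<integral>\<^sup>+x. F x \<partial>Rn_lebesgue n) =
    ennreal (\<bar>c\<bar> ^ n) * (\<integral>\<^sup>+x. F (\<lambda>i\<in>{..<n}. t i + c * x i) \<partial>Rn_lebesgue n)"
proof -
  interpret product_sigma_finite "\<lambda>_::nat. lborel :: real measure" ..
  define T where "T x = (\<lambda>i\<in>{..<n}. t i + c * x i)" for x
  have T: "T \<in> Rn_lebesgue n \<rightarrow>\<^sub>M Rn_lebesgue n"
    unfolding T_def Rn_lebesgue_def
    by (intro measurable_restrict) (simp add: measurable_lborel2)
  define P where "P = scale_measure (ennreal (\<bar>c\<bar> ^ n)) (distr (Rn_lebesgue n) (Rn_lebesgue n) T)"
  have P: "P = Rn_lebesgue n"
    unfolding Rn_lebesgue_def
  proof (rule PiM_eqI)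
    show "finite {..<n}" by simp
    show "sets P = sets (\<Pi>\<^sub>M i\<in>{..<n}. lborel)" by (simp add: P_def Rn_lebesgue_def)
    fix A :: "nat \<Rightarrow> real set" assume A: "\<And>i. i \<in> {..<n} \<Longrightarrow> A i \<in> sets lborel"
    define A' where "A' i = (\<lambda>x. t i + c * x) -` A i" for i
    have A': "A' i \<in> sets lborel" if "i < n" for i
    proof -
      have "(\<lambda>x. t i + c * x) \<in> borel \<rightarrow>\<^sub>M borel" by simp
      from measurable_sets[OF this, of "A i"] A[of i] that show ?thesis by (simp add: A'_def)
    qed
    have "T -` (\<Pi>\<^sub>E i\<in>{..<n}. A i) \<inter> Rn n = (\<Pi>\<^sub>E i\<in>{..<n}. A' i)"
      by (auto simp: T_def A'_def Rn_def PiE_def Pi_def)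
    moreover have "(\<Pi>\<^sub>E i\<in>{..<n}. A i) \<in> sets (Rn_lebesgue n)"
      unfolding Rn_lebesgue_def using A by (intro sets_PiM_I_finite) auto
    ultimately have "emeasure P (\<Pi>\<^sub>E i\<in>{..<n}. A i) = ennreal (\<bar>c\<bar> ^ n) * emeasure (Rn_lebesgue n) (\<Pi>\<^sub>E i\<in>{..<n}. A' i)"
      by (simp add: P_def emeasure_distr[OF T])
    also have "\<dots> = (\<Prod>i<n. ennreal \<bar>c\<bar> * emeasure lborel (A' i))"
      unfolding Rn_lebesgue_def using A'
      by (subst emeasure_PiM) (auto simp: prod.distrib ennreal_power)
    also have "\<dots> = (\<Prod>i<n. emeasure lborel (A i))"
    proof (rule prod.cong[OF refl])
      fix i assume "i \<in> {..<n}"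
      then have [measurable]: "A i \<in> sets borel" using A by auto
      show "ennreal \<bar>c\<bar> * emeasure lborel (A' i) = emeasure lborel (A i)"
        by (subst (2) lborel_real_affine[OF c, of "t i"])
           (simp add: emeasure_density nn_integral_cmult emeasure_distr A'_def)
    qed
    finally show "emeasure P (\<Pi>\<^sub>E i\<in>{..<n}. A i) = (\<Prod>i<n. emeasure lborel (A i))" .
  qed
  have FL: "F \<in> borel_measurable (Rn_lebesgue n)"
    using F measurable_cong_sets[OF sets_Rn_lebesgue refl] by blast
  have "(\<integral>\<^sup>+x. F x \<partial>Rn_lebesgue n) = (\<integral>\<^sup>+x. F x \<partial>P)" by (simp add: P)
  also have "\<dots> = ennreal (\<bar>c\<bar> ^ n) * (\<integral>\<^sup>+x. F (T x) \<partial>Rn_lebesgue n)"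
    unfolding P_def using FL T by (simp add: nn_integral_scale_measure nn_integral_distr)
  finally show ?thesis unfolding T_def .
qed

subsection \<open>Covering numbers and integrals of sup-convolutions\<close>

lemma measurable_Rn_lebesgue_iff:
  "F \<in> M \<rightarrow>\<^sub>M Rn_lebesgue n \<longleftrightarrow> F \<in> M \<rightarrow>\<^sub>M (\<Pi>\<^sub>M i\<in>{..<n}. (borel :: real measure))"
  "G \<in> Rn_lebesgue n \<rightarrow>\<^sub>M N \<longleftrightarrow> G \<in> (\<Pi>\<^sub>M i\<in>{..<n}. (borel :: real measure)) \<rightarrow>\<^sub>M N"
  using measurable_cong_sets[OF refl sets_Rn_lebesgue] measurable_cong_sets[OF sets_Rn_lebesgue refl]
  by blast+

lemma Rn_integral_mono:
  "(\<And>x. x \<in> Rn n \<Longrightarrow> f x \<le> g x) \<Longrightarrow> Rn_integral n f \<le> Rn_integral n g"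
  unfolding Rn_integral_def by (intro nn_integral_mono ennreal_leI) simp

lemma sigma_finite_Rn_lebesgue: "sigma_finite_measure (Rn_lebesgue n)"
proof -
  interpret product_sigma_finite "\<lambda>_::nat. lborel :: real measure" ..
  show ?thesis unfolding Rn_lebesgue_def by (rule sigma_finite) simp
qed

lemma nn_integral_Rn_translate:
  assumes "F \<in> borel_measurable (\<Pi>\<^sub>M i\<in>{..<n}. (borel :: real measure))"
  shows "(\<integral>\<^sup>+x. F (Rn_diff n x t) \<partial>Rn_lebesgue n) = (\<integral>\<^sup>+x. F x \<partial>Rn_lebesgue n)"
  using nn_integral_Rn_affine[OF assms, of 1 "\<lambda>i. - t i"] by (simp add: Rn_diff_def add.commute)

lemma nn_integral_Rn_reflect:
  assumes "F \<in> borel_measurable (\<Pi>\<^sub>M i\<in>{..<n}. (borel :: real measure))"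
  shows "(\<integral>\<^sup>+t. F (Rn_diff n x t) \<partial>Rn_lebesgue n) = (\<integral>\<^sup>+x. F x \<partial>Rn_lebesgue n)"
  using nn_integral_Rn_affine[OF assms, of "-1" x] by (simp add: Rn_diff_def)

text \<open>For fixed \<open>z\<close>, multiply the covering inequality at \<open>z\<close> by h(x
  - z). Because (x - t) - (z - t) = x - z, the integrand g(z - t) h(x - z) is one of the products
  whose supremum is \<open>sup_conv n g h\<close> at x - t.\<close>

lemma sup_conv_le_covering:
  assumes f: "unit_usc n f" and g: "unit_usc n g" and h: "unit_usc n h"
    and \<mu>: "\<mu> \<in> covering_measures n f g" and x: "x \<in> Rn n"
  shows "ennreal (sup_conv n f h x) \<le> (\<integral>\<^sup>+t. ennreal (sup_conv n g h (Rn_diff n x t)) \<partial>\<mu>)"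
proof (rule ennreal_sup_conv_least[OF f h])
  fix z assume z: "z \<in> Rn n"
  have sets: "sets \<mu> = sets (\<Pi>\<^sub>M i\<in>{..<n}. (borel :: real measure))"
    using \<mu> by (simp add: covering_measures_def)
  have space: "space \<mu> = Rn n" using sets_eq_imp_space_eq[OF sets] by simp
  have id: "(\<lambda>t. t) \<in> \<mu> \<rightarrow>\<^sub>M (\<Pi>\<^sub>M i\<in>{..<n}. (borel :: real measure))"
    using sets by (rule measurable_ident_sets)
  have "(\<lambda>t. Rn_diff n z t) \<in> \<mu> \<rightarrow>\<^sub>M (\<Pi>\<^sub>M i\<in>{..<n}. (borel :: real measure))"
    using z by (intro measurable_Rn_diff id measurable_const) simp
  then have meas: "(\<lambda>t. ennreal (g (Rn_diff n z t))) \<in> borel_measurable \<mu>"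
    using measurable_compose[OF _ unit_uscD(4)[OF g]] by (intro measurable_compose[OF _ measurable_ennreal]) blast
  have h0: "0 \<le> h (Rn_diff n x z)" using unit_uscD[OF h] by simp
  have "ennreal (f z * h (Rn_diff n x z)) = ennreal (f z) * ennreal (h (Rn_diff n x z))"
    using unit_uscD[OF f] z h0 by (simp add: ennreal_mult)
  also have "\<dots> \<le> (\<integral>\<^sup>+t. ennreal (g (Rn_diff n z t)) \<partial>\<mu>) * ennreal (h (Rn_diff n x z))"
    using \<mu> z by (intro mult_right_mono) (auto simp: covering_measures_def)
  also have "\<dots> = (\<integral>\<^sup>+t. ennreal (g (Rn_diff n z t)) * ennreal (h (Rn_diff n x z)) \<partial>\<mu>)"
    using meas by (rule nn_integral_multc[symmetric])
  also have "\<dots> \<le> (\<integral>\<^sup>+t. ennreal (sup_conv n g h (Rn_diff n x t)) \<partial>\<mu>)"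
  proof (rule nn_integral_mono)
    fix t
    have "Rn_diff n (Rn_diff n x t) (Rn_diff n z t) = Rn_diff n x z"
      by (auto simp: Rn_diff_def)
    then have "g (Rn_diff n z t) * h (Rn_diff n x z) \<le> sup_conv n g h (Rn_diff n x t)"
      using sup_conv_upper[OF g h, of "Rn_diff n z t" "Rn_diff n x t"] by simp
    then show "ennreal (g (Rn_diff n z t)) * ennreal (h (Rn_diff n x z)) \<le> ennreal (sup_conv n g h (Rn_diff n x t))"
      using unit_uscD(1)[OF g] h0 by (simp add: ennreal_mult[symmetric] ennreal_leI)
  qed
  finally show "ennreal (f z * h (Rn_diff n x z)) \<le> (\<integral>\<^sup>+t. ennreal (sup_conv n g h (Rn_diff n x t)) \<partial>\<mu>)" .
qed

lemma integral_sup_conv_le_covering: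
  assumes f: "unit_usc n f" and g: "unit_usc n g" and h: "unit_usc n h"
    and \<mu>: "\<mu> \<in> covering_measures n f g" and fin: "emeasure \<mu> (Rn n) < \<infinity>"
  shows "Rn_integral n (sup_conv n f h) \<le> emeasure \<mu> (Rn n) * Rn_integral n (sup_conv n g h)"
proof -
  let ?B = "\<Pi>\<^sub>M i\<in>{..<n}. (borel :: real measure)"
  let ?G = "\<lambda>x. ennreal (sup_conv n g h x)"
  have sets: "sets \<mu> = sets ?B"
    using \<mu> by (simp add: covering_measures_def)
  have space: "space \<mu> = Rn n" using sets_eq_imp_space_eq[OF sets] by simp
  \<comment> \<open>Members of \<open>covering_measures\<close> may have infinite mass; finiteness
    supplies the sigma-finiteness required for exchanging the integrals.\<close>
  interpret \<mu>: finite_measure \<mu> using fin space by (intro finite_measureI) auto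
  interpret L: sigma_finite_measure "Rn_lebesgue n" by (rule sigma_finite_Rn_lebesgue)
  interpret pair_sigma_finite \<mu> "Rn_lebesgue n" ..
  have G: "?G \<in> borel_measurable ?B"
    using borel_measurable_sup_conv[OF g h] by measurable
  have "(\<lambda>p. snd p) \<in> \<mu> \<Otimes>\<^sub>M Rn_lebesgue n \<rightarrow>\<^sub>M ?B" "(\<lambda>p. fst p) \<in> \<mu> \<Otimes>\<^sub>M Rn_lebesgue n \<rightarrow>\<^sub>M ?B"
    using measurable_snd[of \<mu> "Rn_lebesgue n"] measurable_fst[of \<mu> "Rn_lebesgue n"]
      measurable_cong_sets[OF refl sets] measurable_Rn_lebesgue_iff(1) by blast+
  then have "(\<lambda>p. Rn_diff n (snd p) (fst p)) \<in> \<mu> \<Otimes>\<^sub>M Rn_lebesgue n \<rightarrow>\<^sub>M ?B"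
    by (rule measurable_Rn_diff)
  from measurable_compose[OF this G]
  have joint: "(\<lambda>(t, x). ?G (Rn_diff n x t)) \<in> borel_measurable (\<mu> \<Otimes>\<^sub>M Rn_lebesgue n)"
    by (simp add: case_prod_beta)
  have "Rn_integral n (sup_conv n f h) \<le> (\<integral>\<^sup>+x. (\<integral>\<^sup>+t. ?G (Rn_diff n x t) \<partial>\<mu>) \<partial>Rn_lebesgue n)"
    unfolding Rn_integral_def using sup_conv_le_covering[OF f g h \<mu>] by (intro nn_integral_mono) simp
  also have "\<dots> = (\<integral>\<^sup>+t. (\<integral>\<^sup>+x. ?G (Rn_diff n x t) \<partial>Rn_lebesgue n) \<partial>\<mu>)"
    using Fubini'[OF joint] .
  also have "\<dots> = (\<integral>\<^sup>+t. Rn_integral n (sup_conv n g h) \<partial>\<mu>)"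
    unfolding Rn_integral_def using nn_integral_Rn_translate[OF G] by simp
  also have "\<dots> = emeasure \<mu> (Rn n) * Rn_integral n (sup_conv n g h)"
    by (simp add: space mult.commute)
  finally show ?thesis .
qed

text \<open>The infimum need not be attained; the strict bound provides an actual covering measure,
  of mass below \<open>c\<close> and hence finite.\<close>

lemma integral_sup_conv_le_covering_number:
  assumes "unit_usc n f" "unit_usc n g" "unit_usc n h"
    and "covering_number n f g < ennreal c"
  shows "Rn_integral n (sup_conv n f h) \<le> ennreal c * Rn_integral n (sup_conv n g h)"
proof -
  obtain \<mu> where \<mu>: "\<mu> \<in> covering_measures n f g" "emeasure \<mu> (Rn n) < ennreal c"
    using assms(4) unfolding covering_number_def by (auto simp: INF_less_iff)
  then have "Rn_integral n (sup_conv n f h) \<le> emeasure \<mu> (Rn n) * Rn_integral n (sup_conv n g h)"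
    using assms by (intro integral_sup_conv_le_covering) (auto intro: less_trans)
  also have "\<dots> \<le> ennreal c * Rn_integral n (sup_conv n g h)"
    using \<mu> by (intro mult_right_mono) auto
  finally show ?thesis .
qed

section \<open>Reflections, and covering numbers bounded by integrals\<close>

abbreviation Rn_reflect :: "nat \<Rightarrow> ((nat \<Rightarrow> real) \<Rightarrow> real) \<Rightarrow> (nat \<Rightarrow> real) \<Rightarrow> real" where
  "Rn_reflect n g \<equiv> (\<lambda>x. g (Rn_diff n (Rn_zero n) x))"

lemma topspace_Rn_topology [simp]: "topspace (Rn_topology n) = Rn n"
  by (simp add: Rn_topology_def Rn_def)

lemma continuous_map_Rn_coordinate: "i < n \<Longrightarrow> continuous_map (Rn_topology n) euclideanreal (\<lambda>x. x i)"
  unfolding Rn_topology_def by (rule continuous_map_product_projection) simp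

lemma continuous_map_Rn_inner:
  assumes "continuous_map X (Rn_topology n) f" "continuous_map X (Rn_topology n) g"
  shows "continuous_map X euclideanreal (\<lambda>x. Rn_inner n (f x) (g x))"
  unfolding Rn_inner_def
  by (intro continuous_map_sum continuous_map_real_mult)
     (use continuous_map_compose[OF assms(1) continuous_map_Rn_coordinate]
        continuous_map_compose[OF assms(2) continuous_map_Rn_coordinate] in \<open>auto simp: o_def\<close>)

lemma unit_usc_reflect:
  assumes "unit_usc n g"
  shows "unit_usc n (Rn_reflect n g)"
proof -
  have cont: "continuous_map (Rn_topology n) (Rn_topology n) (\<lambda>x. Rn_diff n (Rn_zero n) x)"
    unfolding Rn_topology_def continuous_map_componentwise
  proof (intro conjI ballI)
    fix i assume "i \<in> {..<n}"
    then show "continuous_map (product_topology (\<lambda>_. euclideanreal) {..<n}) euclideanreal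
        (\<lambda>x. Rn_diff n (Rn_zero n) x i)"
      using continuous_map_Rn_coordinate[of i n, unfolded Rn_topology_def]
      by (simp add: Rn_diff_def Rn_zero_def continuous_map_minus)
  qed (auto simp: Rn_diff_def)
  have "openin (Rn_topology n) {x \<in> Rn n. Rn_diff n (Rn_zero n) x \<in> {x \<in> Rn n. g x < a}}" for a
    using openin_continuous_map_preimage[OF cont, of "{x \<in> Rn n. g x < a}"] unit_uscD(3)[OF assms]
    unfolding usc_on_Rn_def by simp
  then show ?thesis using unit_uscD(1,2)[OF assms] by (auto simp: unit_usc_def usc_on_Rn_def)
qed

text \<open>The measure with density \<open>t \<mapsto> sup\<^sub>x f x * g (x - t)\<close>, normalised by \<open>\<integral>g\<^sup>2\<close>, covers \<open>f\<close>
  by \<open>g\<close>, because its density is at least \<open>f x * g (x - t)\<close> for every \<open>x\<close>.\<close>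

lemma covering_number_le_integral:
  assumes f: "unit_usc n f" and g: "unit_usc n g"
    and I0: "Rn_integral n (\<lambda>x. (g x)\<^sup>2) \<noteq> 0" and I1: "Rn_integral n (\<lambda>x. (g x)\<^sup>2) \<noteq> \<infinity>"
  shows "covering_number n f g \<le>
    Rn_integral n (sup_conv n f (Rn_reflect n g)) / Rn_integral n (\<lambda>x. (g x)\<^sup>2)"
proof -
  let ?B = "\<Pi>\<^sub>M i\<in>{..<n}. (borel :: real measure)"
  define I where "I = Rn_integral n (\<lambda>x. (g x)\<^sup>2)"
  define F where "F = sup_conv n f (Rn_reflect n g)"
  note g' = unit_usc_reflect[OF g]
  have gm [measurable]: "g \<in> borel_measurable ?B" by (rule unit_uscD(4)[OF g])
  have F [measurable]: "F \<in> borel_measurable ?B"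
    unfolding F_def by (rule borel_measurable_sup_conv[OF f g'])
  then have FL: "(\<lambda>t. ennreal (F t) / I) \<in> borel_measurable (Rn_lebesgue n)"
    unfolding measurable_Rn_lebesgue_iff by measurable
  define \<mu> where "\<mu> = density (Rn_lebesgue n) (\<lambda>t. ennreal (F t) / I)"
  have "\<mu> \<in> covering_measures n f g"
    unfolding covering_measures_def
  proof safe
    fix x assume x: "x \<in> Rn n"
    have f0: "0 \<le> f x" using unit_uscD[OF f] x by simp
    have "(\<lambda>t. Rn_diff n x t) \<in> ?B \<rightarrow>\<^sub>M ?B"
      using x by (intro measurable_Rn_diff measurable_const measurable_ident_sets) auto
    from measurable_compose[OF this gm]
    have [measurable]: "(\<lambda>t. g (Rn_diff n x t)) \<in> borel_measurable ?B" .
    have gx: "(\<lambda>t. ennreal (g (Rn_diff n x t))) \<in> borel_measurable (Rn_lebesgue n)"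
      unfolding measurable_Rn_lebesgue_iff by measurable
    have g2: "(\<lambda>x. ennreal ((g x)\<^sup>2)) \<in> borel_measurable ?B" by measurable
    have "ennreal (f x) = ennreal (f x) * (I / I)" using I0 I1 by (simp add: I_def ennreal_divide_self less_top)
    \<comment> \<open>The substitution of x - t for t preserves the integral of the square of
      \<open>g\<close>.\<close>
    also have "\<dots> = ennreal (f x) / I * (\<integral>\<^sup>+t. ennreal ((g (Rn_diff n x t))\<^sup>2) \<partial>Rn_lebesgue n)"
      unfolding nn_integral_Rn_reflect[OF g2] by (simp add: I_def Rn_integral_def ennreal_times_divide ennreal_divide_times)
    also have "\<dots> = (\<integral>\<^sup>+t. ennreal (f x) / I * ennreal ((g (Rn_diff n x t))\<^sup>2) \<partial>Rn_lebesgue n)"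
      by (rule nn_integral_cmult[symmetric]) (unfold measurable_Rn_lebesgue_iff, measurable)
    also have "\<dots> \<le> (\<integral>\<^sup>+t. ennreal (F t) / I * ennreal (g (Rn_diff n x t)) \<partial>Rn_lebesgue n)"
    proof (rule nn_integral_mono)
      fix t assume "t \<in> space (Rn_lebesgue n)"
      have e: "Rn_diff n (Rn_zero n) (Rn_diff n t x) = Rn_diff n x t"
        by (auto simp: Rn_diff_def Rn_zero_def)
      have gt: "0 \<le> g (Rn_diff n x t)" using unit_uscD(1)[OF g] by simp
      have "f x * g (Rn_diff n x t) \<le> F t"
        using sup_conv_upper[OF f g' x, of t] by (simp add: F_def e)
      then have "ennreal (f x) * ennreal (g (Rn_diff n x t)) \<le> ennreal (F t)"
        using f0 gt by (simp add: ennreal_mult[symmetric] ennreal_leI)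
      \<comment> \<open>One of the two factors g(x - t) is absorbed with f(x) into the density
        \<open>F t\<close>; the other remains as the covering kernel.\<close>
      then have "ennreal (f x) * ennreal (g (Rn_diff n x t)) * (ennreal (g (Rn_diff n x t)) / I)
          \<le> ennreal (F t) * (ennreal (g (Rn_diff n x t)) / I)"
        by (rule mult_right_mono) simp
      then show "ennreal (f x) / I * ennreal ((g (Rn_diff n x t))\<^sup>2) \<le> ennreal (F t) / I * ennreal (g (Rn_diff n x t))"
        using gt by (simp add: power2_eq_square ennreal_mult divide_ennreal_def mult_ac)
    qed
    also have "\<dots> = (\<integral>\<^sup>+t. ennreal (g (Rn_diff n x t)) \<partial>\<mu>)"
      unfolding \<mu>_def by (rule nn_integral_density[symmetric, OF FL gx])
    finally show "ennreal (f x) \<le> (\<integral>\<^sup>+t. ennreal (g (Rn_diff n x t)) \<partial>\<mu>)" .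
  qed (auto simp: \<mu>_def sets_Rn_lebesgue)
  then have "covering_number n f g \<le> emeasure \<mu> (Rn n)"
    unfolding covering_number_def by (rule INF_lower)
  also have "\<dots> = (\<integral>\<^sup>+t. ennreal (F t) / I \<partial>Rn_lebesgue n)"
    unfolding \<mu>_def using FL sets.top[of "Rn_lebesgue n"]
    by (subst emeasure_density) (auto intro!: nn_integral_cong)
  also have "\<dots> = Rn_integral n F / I"
    unfolding Rn_integral_def
    by (rule nn_integral_divide) (unfold measurable_Rn_lebesgue_iff, measurable)
  finally show ?thesis unfolding F_def I_def .
qed

subsection \<open>Gaussian functions\<close>

text \<open>One family for all Gaussians that occur: \<open>c = 1 / 2\<close> is
  \<open>gaussian\<close>, \<open>c = 1\<close> its square, \<open>c = 1 / 4\<close> bounds its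
  sup-convolution with itself, and large \<open>c\<close> gives the narrow test functions.\<close>

definition gauss :: "real \<Rightarrow> nat \<Rightarrow> (nat \<Rightarrow> real) \<Rightarrow> real" where
  "gauss c n x = exp (- c * Rn_inner n x x)"

lemma gaussian_eq_gauss: "gaussian n = gauss (1 / 2) n"
  by (simp add: fun_eq_iff gaussian_def gauss_def)

lemma Rn_inner_self_nonneg: "0 \<le> Rn_inner n x x"
  unfolding Rn_inner_def by (intro sum_nonneg) simp

lemma gauss_reflect: "Rn_reflect n (gauss c n) = gauss c n"
  by (auto simp: fun_eq_iff gauss_def Rn_inner_def Rn_diff_def Rn_zero_def)

lemma gauss_zero [simp]: "gauss c n (Rn_zero n) = 1"
  by (simp add: gauss_def Rn_inner_def Rn_zero_def)

lemma unit_usc_gauss: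
  assumes "0 \<le> c"
  shows "unit_usc n (gauss c n)"
  unfolding unit_usc_def usc_on_Rn_def
proof safe
  fix x assume "x \<in> Rn n"
  show "0 \<le> gauss c n x" by (simp add: gauss_def)
  show "gauss c n x \<le> 1" using assms Rn_inner_self_nonneg[of n x] by (simp add: gauss_def)
next
  fix a
  have "continuous_map (Rn_topology n) euclideanreal (\<lambda>x. Rn_inner n x x)"
    by (intro continuous_map_Rn_inner continuous_map_id[unfolded id_def])
  moreover have "continuous_map euclideanreal euclideanreal (\<lambda>r. exp (- c * r))"
    by (auto simp: continuous_map_iff_continuous2 intro!: continuous_intros)
  ultimately have "continuous_map (Rn_topology n) euclideanreal ((\<lambda>r. exp (- c * r)) \<circ> (\<lambda>x. Rn_inner n x x))"
    by (rule continuous_map_compose)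
  then have "continuous_map (Rn_topology n) euclideanreal (gauss c n)"
    by (simp add: o_def gauss_def[abs_def])
  from openin_continuous_map_preimage[OF this, of "{..<a}"]
  show "openin (Rn_topology n) {x \<in> Rn n. gauss c n x < a}" by simp
qed

lemma nn_integral_gauss_1:
  assumes "0 < c"
  shows "(\<integral>\<^sup>+x. ennreal (exp (- c * x\<^sup>2)) \<partial>lborel) = ennreal (sqrt (pi / c))"
proof -
  \<comment> \<open>The standard deviation for which the exponent of the normal density is
    \<open>- c * x\<^sup>2\<close>.\<close>
  define s where "s = sqrt (1 / (2 * c))"
  have s: "0 < s" "s\<^sup>2 = 1 / (2 * c)" using assms by (auto simp: s_def)
  have eq: "exp (- c * x\<^sup>2) = sqrt (pi / c) * normal_density 0 s x" for x
    using assms by (simp add: normal_density_def s(2) field_simps)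
  have "(\<integral>\<^sup>+x. ennreal (normal_density 0 s x) \<partial>lborel) = 1"
    using s(1) by (subst nn_integral_eq_integral) auto
  then show ?thesis
    unfolding eq using assms
    by (simp add: ennreal_mult nn_integral_cmult)
qed

lemma Rn_integral_gauss:
  assumes "0 < c"
  shows "Rn_integral n (gauss c n) = ennreal (sqrt (pi / c) ^ n)"
proof -
  interpret product_sigma_finite "\<lambda>_::nat. lborel :: real measure" ..
  have "ennreal (gauss c n x) = (\<Prod>i<n. ennreal (exp (- c * (x i)\<^sup>2)))" for x
    by (simp add: gauss_def Rn_inner_def prod_ennreal exp_sum[symmetric] sum_distrib_left
        sum_negf power2_eq_square)
  then have "Rn_integral n (gauss c n) = (\<Prod>i<n. \<integral>\<^sup>+x. ennreal (exp (- c * x\<^sup>2)) \<partial>lborel)"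
    unfolding Rn_integral_def Rn_lebesgue_def
    by (simp add: product_nn_integral_prod[where f = "\<lambda>_ y. ennreal (exp (- c * y\<^sup>2))", simplified])
  then show ?thesis using assms by (simp add: nn_integral_gauss_1[OF assms, simplified] ennreal_power)
qed

lemma convex_square:
  fixes a b t :: real
  assumes "0 \<le> t" "t \<le> 1"
  shows "((1 - t) * a + t * b)\<^sup>2 \<le> (1 - t) * a\<^sup>2 + t * b\<^sup>2"
proof -
  have "(1 - t) * a\<^sup>2 + t * b\<^sup>2 - ((1 - t) * a + t * b)\<^sup>2 = t * (1 - t) * (a - b)\<^sup>2" by algebra
  also have "\<dots> \<ge> 0" using assms by simp
  finally show ?thesis by simp
qed

lemma gauss_LCg:
  assumes "0 < c"
  shows "gauss c n \<in> LCg n"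
  unfolding LCg_def mem_Collect_eq
proof (intro conjI)
  show "convex_on_Rn n (\<lambda>x. neg_log (gauss c n x))"
    unfolding convex_on_Rn_def
  proof (intro ballI)
    fix x y and t :: real assume t: "t \<in> {0..1}"
    have "Rn_inner n (Rn_comb n t x y) (Rn_comb n t x y) = (\<Sum>i<n. ((1 - t) * x i + t * y i)\<^sup>2)"
      by (simp add: Rn_inner_def Rn_comb_def power2_eq_square)
    also have "\<dots> \<le> (\<Sum>i<n. (1 - t) * (x i)\<^sup>2 + t * (y i)\<^sup>2)"
      using t by (intro sum_mono convex_square) auto
    also have "\<dots> = (1 - t) * Rn_inner n x x + t * Rn_inner n y y"
      by (simp add: Rn_inner_def power2_eq_square sum.distrib sum_distrib_left)
    finally have "c * Rn_inner n (Rn_comb n t x y) (Rn_comb n t x y)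
        \<le> c * ((1 - t) * Rn_inner n x x + t * Rn_inner n y y)"
      using assms by (intro mult_left_mono) auto
    then show "neg_log (gauss c n (Rn_comb n t x y))
        \<le> ereal (1 - t) * neg_log (gauss c n x) + ereal t * neg_log (gauss c n y)"
      by (simp add: neg_log_def gauss_def algebra_simps)
  qed
qed (use assms unit_usc_gauss[of c n] in \<open>auto simp: unit_usc_def Rn_integral_gauss\<close>)

text \<open>Completing the square leaves the nonnegative remainder |z - x/2|^2. The bound has an
  explicit integral, which fixes the constants in the passage from volumes to coverings.\<close>

lemma sup_conv_gaussian_le:
  "sup_conv n (gaussian n) (gaussian n) x \<le> gauss (1 / 4) n x"
proof (rule sup_conv_least)
  fix z
  have "Rn_inner n x x / 4 = (\<Sum>i<n. x i * x i / 4)"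
    by (simp add: Rn_inner_def sum_divide_distrib)
  also have "\<dots> \<le> (\<Sum>i<n. z i * z i / 2 + (x i - z i) * (x i - z i) / 2)"
  proof (rule sum_mono)
    fix i
    have "z i * z i / 2 + (x i - z i) * (x i - z i) / 2 - x i * x i / 4 = (z i - x i / 2)\<^sup>2"
      by (simp add: power2_eq_square field_simps)
    then show "x i * x i / 4 \<le> z i * z i / 2 + (x i - z i) * (x i - z i) / 2"
      by (smt (verit) zero_le_power2)
  qed
  also have "\<dots> = Rn_inner n z z / 2 + Rn_inner n (Rn_diff n x z) (Rn_diff n x z) / 2"
    by (simp add: Rn_inner_def Rn_diff_def sum.distrib sum_divide_distrib)
  finally show "gaussian n z * gaussian n (Rn_diff n x z) \<le> gauss (1 / 4) n x"
    by (simp add: gaussian_def gauss_def mult_exp_exp)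
qed

section \<open>Symmetries of sup-convolution\<close>

lemma sup_conv_commute:
  assumes "unit_usc n f" "unit_usc n h" "x \<in> Rn n"
  shows "sup_conv n f h x = sup_conv n h f x"
proof -
  have *: "sup_conv n k l x \<le> sup_conv n l k x" if "unit_usc n k" "unit_usc n l" for k l
  proof (rule sup_conv_least)
    fix z assume "z \<in> Rn n"
    then have "Rn_diff n x (Rn_diff n x z) = z"
      using assms(3) by (intro Rn_eqI[OF Rn_diff_in]) (auto simp: Rn_diff_def)
    then show "k z * l (Rn_diff n x z) \<le> sup_conv n l k x"
      using sup_conv_upper[OF that(2,1), of "Rn_diff n x z" x] by (simp add: mult.commute)
  qed
  show ?thesis using *[of f h] *[of h f] assms by (intro antisym) auto
qed

text \<open>Reflecting both factors reflects the sup-convolution, which leaves the integral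
  unchanged; commutativity accounts for the swapped order. Covering the Gaussian by \<open>f\<close>
  produces the integral on the left, while the volume position controls the one on the
  right.\<close>

lemma Rn_integral_sup_conv_reflect:
  assumes f: "unit_usc n f" and h: "unit_usc n h"
  shows "Rn_integral n (sup_conv n (Rn_reflect n h) (Rn_reflect n f)) = Rn_integral n (sup_conv n f h)"
proof -
  have le: "sup_conv n (Rn_reflect n k) (Rn_reflect n l) x \<le> sup_conv n k l (Rn_diff n (Rn_zero n) x)"
    if "unit_usc n k" "unit_usc n l" for k l x
  proof (rule sup_conv_least)
    fix z
    have "Rn_diff n (Rn_diff n (Rn_zero n) x) (Rn_diff n (Rn_zero n) z) = Rn_diff n (Rn_zero n) (Rn_diff n x z)"
      by (auto simp: Rn_diff_def Rn_zero_def)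
    then show "Rn_reflect n k z * Rn_reflect n l (Rn_diff n x z) \<le> sup_conv n k l (Rn_diff n (Rn_zero n) x)"
      using sup_conv_upper[OF that, of "Rn_diff n (Rn_zero n) z" "Rn_diff n (Rn_zero n) x"] by simp
  qed
  have inv: "Rn_diff n (Rn_zero n) (Rn_diff n (Rn_zero n) x) = x" if "x \<in> Rn n" for x
    using that by (intro Rn_eqI[OF Rn_diff_in]) (auto simp: Rn_diff_def Rn_zero_def)
  note f' = unit_usc_reflect[OF f] and h' = unit_usc_reflect[OF h]
  have "sup_conv n (Rn_reflect n h) (Rn_reflect n f) x = sup_conv n f h (Rn_diff n (Rn_zero n) x)"
    if x: "x \<in> Rn n" for x
  proof (rule antisym)
    show "sup_conv n (Rn_reflect n h) (Rn_reflect n f) x \<le> sup_conv n f h (Rn_diff n (Rn_zero n) x)"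
      using le[OF h f] sup_conv_commute[OF h f] by simp
    have "sup_conv n h f (Rn_diff n (Rn_zero n) x) \<le> sup_conv n (Rn_reflect n h) (Rn_reflect n f) x"
    proof (rule sup_conv_least)
      fix z assume z: "z \<in> Rn n"
      have "Rn_diff n (Rn_zero n) (Rn_diff n x (Rn_diff n (Rn_zero n) z)) = Rn_diff n (Rn_diff n (Rn_zero n) x) z"
        by (auto simp: Rn_diff_def Rn_zero_def)
      then show "h z * f (Rn_diff n (Rn_diff n (Rn_zero n) x) z) \<le> sup_conv n (Rn_reflect n h) (Rn_reflect n f) x"
        using sup_conv_upper[OF h' f', of "Rn_diff n (Rn_zero n) z" x] inv[OF z] by simp
    qed
    then show "sup_conv n f h (Rn_diff n (Rn_zero n) x) \<le> sup_conv n (Rn_reflect n h) (Rn_reflect n f) x"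
      using sup_conv_commute[OF h f] by simp
  qed
  then have "Rn_integral n (sup_conv n (Rn_reflect n h) (Rn_reflect n f))
      = (\<integral>\<^sup>+x. ennreal (sup_conv n f h (Rn_diff n (Rn_zero n) x)) \<partial>Rn_lebesgue n)"
    unfolding Rn_integral_def by (intro nn_integral_cong) simp
  also have "\<dots> = Rn_integral n (sup_conv n f h)"
    unfolding Rn_integral_def using borel_measurable_sup_conv[OF f h]
    by (intro nn_integral_Rn_reflect) measurable
  finally show ?thesis .
qed

subsection \<open>The dual function\<close>

text \<open>The dual at \<open>y\<close> is the infimum over \<open>x\<close> of exp(-<y,x>) / f(x).
  With the denominator cleared, zeros of \<open>f\<close> impose no condition, and the facts about
  the dual below follow from real inequalities.\<close>

lemma le_dual_fun_iff:
  assumes f: "unit_usc n f" and f0: "f (Rn_zero n) = 1"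
  shows "a \<le> dual_fun n f y \<longleftrightarrow> (\<forall>x\<in>Rn n. a * f x \<le> exp (- Rn_inner n y x))"
proof -
  define L where "L = legendre n (\<lambda>x. neg_log (f x)) y"
  \<comment> \<open>Testing the supremum at the origin gives \<open>0 \<le> L\<close>, which rules
    out the arbitrary value of \<open>exp_neg\<close> at minus infinity.\<close>
  have "ereal (Rn_inner n y (Rn_zero n)) - neg_log (f (Rn_zero n)) \<le> L"
    unfolding L_def legendre_def by (intro SUP_upper) simp
  then have L0: "0 \<le> L" by (simp add: f0 neg_log_def) (simp add: Rn_inner_def Rn_zero_def zero_ereal_def)
  have dual: "dual_fun n f y = exp_neg L" by (simp add: dual_fun_def L_def)
  have e0: "0 \<le> exp_neg L" by (cases L) (auto simp: exp_neg_def)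
  have le_iff: "a \<le> exp_neg L \<longleftrightarrow> L \<le> ereal (- ln a)" if "0 < a"
  proof (cases L)
    case (real r)
    have "a \<le> exp (- r) \<longleftrightarrow> ln a \<le> - r" using that ln_le_cancel_iff[of a "exp (- r)"] by simp
    then show ?thesis using real by (auto simp: exp_neg_def)
  qed (use L0 that in \<open>auto simp: exp_neg_def\<close>)
  show ?thesis
  proof (cases "0 < a")
    case False
    then have "a * f x \<le> exp (- Rn_inner n y x)" if "x \<in> Rn n" for x
      using unit_uscD(1)[OF f that] mult_nonpos_nonneg[of a "f x"] exp_gt_zero[of "- Rn_inner n y x"] by linarith
    then show ?thesis using False e0 by (auto simp: dual)
  next
    case True
    have "ereal (Rn_inner n y x) - neg_log (f x) \<le> ereal (- ln a) \<longleftrightarrow> a * f x \<le> exp (- Rn_inner n y x)"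
      if x: "x \<in> Rn n" for x
    proof (cases "f x = 0")
      case False
      then have fx: "0 < f x" using unit_uscD(1)[OF f x] by simp
      have "a * f x \<le> exp (- Rn_inner n y x) \<longleftrightarrow> ln (a * f x) \<le> - Rn_inner n y x"
        using fx True by (subst ln_le_cancel_iff[symmetric]) auto
      also have "\<dots> \<longleftrightarrow> Rn_inner n y x + ln (f x) \<le> - ln a"
        using fx True by (auto simp: ln_mult)
      finally show ?thesis using False by (simp add: neg_log_def)
    qed (simp add: neg_log_def)
    then show ?thesis
      unfolding dual le_iff[OF True] unfolding L_def legendre_def by (simp add: SUP_le_iff)
  qed
qed

text \<open>The bounds come from \<open>a = 0\<close> and from testing at the origin. A strict
  sublevel set is a union over \<open>x\<close> of sets defined by an open condition on <y,x>, hence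
  open.\<close>

lemma unit_usc_dual_fun:
  assumes f: "unit_usc n f" and f0: "f (Rn_zero n) = 1"
  shows "unit_usc n (dual_fun n f)"
  unfolding unit_usc_def usc_on_Rn_def
proof safe
  note iff = le_dual_fun_iff[OF f f0]
  fix y assume "y \<in> Rn n"
  show "0 \<le> dual_fun n f y" unfolding iff by simp
  have "dual_fun n f y * f (Rn_zero n) \<le> exp (- Rn_inner n y (Rn_zero n))"
    using iff[of "dual_fun n f y" y] by (meson order_refl Rn_zero_in)
  then show "dual_fun n f y \<le> 1" by (simp add: f0) (simp add: Rn_inner_def Rn_zero_def)
next
  fix a
  have "{y \<in> Rn n. dual_fun n f y < a} =
      (\<Union>x\<in>Rn n. {y \<in> topspace (Rn_topology n). Rn_inner n y x \<in> {r. exp (- r) < a * f x}})"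
    using le_dual_fun_iff[OF f f0, of a] by (auto simp: not_le[symmetric])
  moreover have "openin (Rn_topology n) {y \<in> topspace (Rn_topology n). Rn_inner n y x \<in> {r. exp (- r) < b}}"
    if "x \<in> Rn n" for x b
    using that
    by (intro openin_continuous_map_preimage[of _ euclideanreal] continuous_map_Rn_inner
        continuous_map_id[unfolded id_def])
      (auto intro!: open_Collect_less continuous_intros)
  ultimately show "openin (Rn_topology n) {y \<in> Rn n. dual_fun n f y < a}"
    by auto
qed

section \<open>Halving inequalities\<close>

definition Rn_half :: "nat \<Rightarrow> (nat \<Rightarrow> real) \<Rightarrow> nat \<Rightarrow> real" where
  "Rn_half n x = (\<lambda>i\<in>{..<n}. 1 / 2 * x i)"

text \<open>As \<open>f\<close> takes values in [0,1], its square is at most \<open>f\<close>. So if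
  \<open>s * f x\<close> is at most exp(-<y,x>) for all \<open>x\<close>, taking roots shows that
  \<open>sqrt s\<close> is admissible at y/2.\<close>

lemma dual_fun_half:
  assumes f: "unit_usc n f" and f0: "f (Rn_zero n) = 1"
    and y: "y \<in> Rn n"
  shows "dual_fun n f y \<le> (dual_fun n f (Rn_half n y))\<^sup>2"
proof -
  define s where "s = dual_fun n f y"
  have s0: "0 \<le> s" using unit_uscD(1)[OF unit_usc_dual_fun[OF f f0] y] by (simp add: s_def)
  have "sqrt s \<le> dual_fun n f (Rn_half n y)"
    unfolding le_dual_fun_iff[OF f f0]
  proof
    fix x assume x: "x \<in> Rn n"
    have inner: "Rn_inner n (Rn_half n y) x = Rn_inner n y x / 2"
      by (simp add: Rn_inner_def Rn_half_def sum_divide_distrib)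
    have "(sqrt s * f x)\<^sup>2 = s * (f x * f x)" using s0 by (simp add: power_mult_distrib power2_eq_square)
    also have "\<dots> \<le> s * f x"
      using unit_uscD(1,2)[OF f x] s0 by (intro mult_left_mono mult_left_le) auto
    also have "\<dots> \<le> exp (- Rn_inner n y x)"
      using le_dual_fun_iff[OF f f0, of s y] x by (simp add: s_def)
    also have "\<dots> = (exp (- Rn_inner n (Rn_half n y) x))\<^sup>2"
      by (simp add: inner power2_eq_square mult_exp_exp)
    finally show "sqrt s * f x \<le> exp (- Rn_inner n (Rn_half n y) x)"
      by (rule power2_le_imp_le) simp
  qed
  then have "(sqrt s)\<^sup>2 \<le> (dual_fun n f (Rn_half n y))\<^sup>2"
    using s0 by (intro power_mono) auto
  then show ?thesis using s0 by (simp add: s_def)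
qed

text \<open>Convexity of -log f at the midpoint of the origin and \<open>x\<close>, where the term
  at the origin vanishes.\<close>

lemma LCg_half:
  assumes f: "f \<in> LCg n" and x: "x \<in> Rn n"
  shows "f x \<le> (f (Rn_half n x))\<^sup>2"
proof (cases "f x = 0")
  case False
  have b: "0 \<le> f x" "0 \<le> f (Rn_half n x)" "f (Rn_zero n) = 1"
    using f x by (auto simp: LCg_def Rn_half_def Rn_def)
  have conv: "convex_on_Rn n (\<lambda>x. neg_log (f x))" using f by (simp add: LCg_def)
  have "neg_log (f (Rn_comb n (1/2) (Rn_zero n) x))
      \<le> ereal (1 - 1/2) * neg_log (f (Rn_zero n)) + ereal (1/2) * neg_log (f x)"
    using conv[unfolded convex_on_Rn_def, rule_format, OF Rn_zero_in x, of "1/2"] by simp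
  moreover have "Rn_comb n (1/2) (Rn_zero n) x = Rn_half n x"
    by (auto simp: Rn_comb_def Rn_half_def Rn_zero_def)
  ultimately have le: "neg_log (f (Rn_half n x)) \<le> ereal (- ln (f x) / 2)"
    using False by (simp add: b(3) neg_log_def)
  then have h0: "f (Rn_half n x) \<noteq> 0" by (auto simp: neg_log_def)
  with le have "ln (f x) \<le> 2 * ln (f (Rn_half n x))" by (simp add: neg_log_def)
  also have "\<dots> = ln ((f (Rn_half n x))\<^sup>2)" using h0 b(2) by (simp add: ln_realpow)
  finally show ?thesis using h0 b False by (subst (asm) ln_le_cancel_iff) auto
qed simp

text \<open>The substitution of x/2 for x costs the factor 2^(-n). The result bounds from below the
  denominator in \<open>covering_number_le_integral\<close>.\<close>

lemma Rn_integral_le_square: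
  assumes F: "F \<in> borel_measurable (\<Pi>\<^sub>M i\<in>{..<n}. (borel :: real measure))"
    and half: "\<And>x. x \<in> Rn n \<Longrightarrow> F x \<le> (F (Rn_half n x))\<^sup>2"
  shows "ennreal ((1 / 2) ^ n) * Rn_integral n F \<le> Rn_integral n (\<lambda>x. (F x)\<^sup>2)"
proof -
  have "(\<lambda>x. ennreal ((F x)\<^sup>2)) \<in> borel_measurable (\<Pi>\<^sub>M i\<in>{..<n}. (borel :: real measure))"
    using F by measurable
  from nn_integral_Rn_affine[OF this, of "1 / 2" "\<lambda>_. 0"]
  have "Rn_integral n (\<lambda>x. (F x)\<^sup>2)
      = ennreal ((1 / 2) ^ n) * (\<integral>\<^sup>+x. ennreal ((F (Rn_half n x))\<^sup>2) \<partial>Rn_lebesgue n)"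
    by (simp add: Rn_integral_def Rn_half_def)
  also have "\<dots> \<ge> ennreal ((1 / 2) ^ n) * Rn_integral n F"
    unfolding Rn_integral_def using half by (intro mult_left_mono nn_integral_mono ennreal_leI) auto
  finally show ?thesis .
qed

subsection \<open>Shrinking Gaussians\<close>

text \<open>Otherwise each \<open>k\<close> has a point \<open>z k\<close> at which both
  \<open>F\<close> and the Gaussian factor exceed \<open>a\<close>. The latter forces
  \<open>z k\<close> to converge to \<open>x\<close>, and upper semicontinuity then makes
  \<open>F (z k)\<close> eventually smaller than \<open>a\<close>.\<close>

lemma sup_conv_narrow_gauss:
  assumes F: "unit_usc n F" and x: "x \<in> Rn n" and a: "F x < a"
  shows "\<exists>k. sup_conv n F (gauss (real (Suc k) / 2) n) x \<le> a"
proof (rule ccontr)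
  assume "\<not> ?thesis"
  then have "\<exists>z\<in>Rn n. a < F z * gauss (real (Suc k) / 2) n (Rn_diff n x z)" for k
    using less_sup_conv_iff[OF F unit_usc_gauss] by (simp add: not_le)
  then obtain z where z: "\<And>k. z k \<in> Rn n"
    and az: "\<And>k. a < F (z k) * gauss (real (Suc k) / 2) n (Rn_diff n x (z k))" by metis
  have a0: "0 < a" using unit_uscD(1)[OF F x] a by simp
  have aF: "a < F (z k)" and ag: "a < gauss (real (Suc k) / 2) n (Rn_diff n x (z k))" for k
  proof -
    have "F (z k) * gauss (real (Suc k) / 2) n (Rn_diff n x (z k)) \<le> F (z k) * 1"
      using unit_uscD(2)[OF unit_usc_gauss] unit_uscD(1)[OF F z] by (intro mult_left_mono) auto
    moreover have "F (z k) * gauss (real (Suc k) / 2) n (Rn_diff n x (z k))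
        \<le> 1 * gauss (real (Suc k) / 2) n (Rn_diff n x (z k))"
      using unit_uscD(2)[OF F z] by (intro mult_right_mono) (auto simp: gauss_def)
    ultimately show "a < F (z k)" "a < gauss (real (Suc k) / 2) n (Rn_diff n x (z k))"
      using az[of k] by auto
  qed
  have "(\<lambda>k. z k i) \<longlonglongrightarrow> x i" if i: "i < n" for i
  proof (rule tendsto_sandwich)
    \<comment> \<open>The radius outside which the Gaussian of parameter
      \<open>real (Suc k) / 2\<close> is below \<open>a\<close>.\<close>
    define e where "e k = sqrt (- 2 * ln a * inverse (real (Suc k)))" for k
    have "\<bar>x i - z k i\<bar> \<le> e k" for k
    proof -
      have "ln a < - (real (Suc k) / 2) * Rn_inner n (Rn_diff n x (z k)) (Rn_diff n x (z k))"
        using ag[of k] a0 by (simp only: gauss_def exp_gt_zero ln_less_cancel_iff[symmetric] ln_exp)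
      then have "Rn_inner n (Rn_diff n x (z k)) (Rn_diff n x (z k)) \<le> - 2 * ln a * inverse (real (Suc k))"
        by (simp add: field_simps del: of_nat_Suc)
      moreover have "(x i - z k i)\<^sup>2 \<le> Rn_inner n (Rn_diff n x (z k)) (Rn_diff n x (z k))"
        unfolding Rn_inner_def Rn_diff_def power2_eq_square
        using i member_le_sum[of i "{..<n}" "\<lambda>i. (x i - z k i) * (x i - z k i)"] by simp
      ultimately show ?thesis
        unfolding e_def by (intro real_le_rsqrt) simp
    qed
    then show "\<forall>\<^sub>F k in sequentially. x i - e k \<le> z k i" "\<forall>\<^sub>F k in sequentially. z k i \<le> x i + e k"
      by (auto intro!: always_eventually simp: abs_le_iff algebra_simps)
    have "e \<longlonglongrightarrow> sqrt (- 2 * ln a * 0)"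
      unfolding e_def by (intro tendsto_intros LIMSEQ_inverse_real_of_nat)
    then have e: "e \<longlonglongrightarrow> 0" by simp
    show "(\<lambda>k. x i - e k) \<longlonglongrightarrow> x i" using tendsto_diff[OF tendsto_const e] by simp
    show "(\<lambda>k. x i + e k) \<longlonglongrightarrow> x i" using tendsto_add[OF tendsto_const e] by simp
  qed
  then have "limitin (Rn_topology n) z x sequentially"
    using x z unfolding Rn_topology_def limitin_componentwise by (auto simp: Rn_def PiE_def)
  moreover have "openin (Rn_topology n) {y \<in> Rn n. F y < a}"
    using unit_uscD(3)[OF F] by (simp add: usc_on_Rn_def)
  ultimately have "\<forall>\<^sub>F k in sequentially. z k \<in> {y \<in> Rn n. F y < a}"
    using x a unfolding limitin_def by blast
  then obtain k where "F (z k) < a" by (auto simp: eventually_sequentially)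
  with aF[of k] show False by simp
qed

text \<open>The sup-convolutions decrease in \<open>k\<close> and their infimum is at most
  \<open>F\<close>, so a lower bound on their integrals passes to \<open>F\<close> by monotone
  convergence. Decreasing limits need one finite integral: the case \<open>k = 0\<close>, which is
  \<open>gaussian\<close>.\<close>

lemma Rn_integral_ge_narrow_gauss:
  assumes F: "unit_usc n F"
    and fin: "Rn_integral n (sup_conv n F (gaussian n)) < \<infinity>"
    and le: "\<And>k. A \<le> Rn_integral n (sup_conv n F (gauss (real (Suc k) / 2) n))"
  shows "A \<le> Rn_integral n F"
proof -
  let ?G = "\<lambda>k x. ennreal (sup_conv n F (gauss (real (Suc k) / 2) n) x)"
  have usc: "unit_usc n (gauss (real (Suc k) / 2) n)" for k by (rule unit_usc_gauss) simp
  have "A \<le> (INF k. Rn_integral n (sup_conv n F (gauss (real (Suc k) / 2) n)))"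
    using le by (rule INF_greatest)
  also have "\<dots> = (\<integral>\<^sup>+x. (INF k. ?G k x) \<partial>Rn_lebesgue n)"
    unfolding Rn_integral_def
  proof (rule nn_integral_monotone_convergence_INF_AE'[symmetric])
    show "?G k \<in> borel_measurable (Rn_lebesgue n)" for k
      unfolding measurable_Rn_lebesgue_iff using borel_measurable_sup_conv[OF F usc] by measurable
    show "(\<integral>\<^sup>+x. ?G 0 x \<partial>Rn_lebesgue n) < \<infinity>"
      using fin by (simp add: Rn_integral_def gaussian_eq_gauss)
    fix k
    have "sup_conv n F (gauss (real (Suc (Suc k)) / 2) n) x \<le> sup_conv n F (gauss (real (Suc k) / 2) n) x" for x
    proof (rule sup_conv_least)
      fix z assume z: "z \<in> Rn n"
      have "gauss (real (Suc (Suc k)) / 2) n y \<le> gauss (real (Suc k) / 2) n y" for y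
        using Rn_inner_self_nonneg[of n y] unfolding gauss_def by (simp add: mult_right_mono)
      then have "F z * gauss (real (Suc (Suc k)) / 2) n (Rn_diff n x z) \<le> F z * gauss (real (Suc k) / 2) n (Rn_diff n x z)"
        using unit_uscD(1)[OF F z] by (intro mult_left_mono) auto
      also have "\<dots> \<le> sup_conv n F (gauss (real (Suc k) / 2) n) x"
        by (rule sup_conv_upper[OF F usc z])
      finally show "F z * gauss (real (Suc (Suc k)) / 2) n (Rn_diff n x z) \<le> sup_conv n F (gauss (real (Suc k) / 2) n) x" .
    qed
    then show "AE x in Rn_lebesgue n. ?G (Suc k) x \<le> ?G k x"
      by (intro AE_I2 ennreal_leI)
  qed
  also have "\<dots> \<le> Rn_integral n F"
    unfolding Rn_integral_def
  proof (rule nn_integral_mono, rule ennreal_le_epsilon)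
    fix x and e :: real assume "x \<in> space (Rn_lebesgue n)" and e: "0 < e"
    then have x: "x \<in> Rn n" by simp
    obtain k where "sup_conv n F (gauss (real (Suc k) / 2) n) x \<le> F x + e"
      using sup_conv_narrow_gauss[OF F x, of "F x + e"] e by auto
    then have "?G k x \<le> ennreal (F x) + ennreal e"
      using unit_uscD(1)[OF F x] e by (simp add: ennreal_plus[symmetric] ennreal_leI del: ennreal_plus)
    then show "(INF k. ?G k x) \<le> ennreal (F x) + ennreal e" by (rule INF_lower2[OF UNIV_I])
  qed
  finally show ?thesis .
qed

subsection \<open>Comparison of the two positions\<close>

lemma gaussian_facts:
  shows unit_usc_gaussian: "unit_usc n (gaussian n)"
    and gaussian_zero: "gaussian n (Rn_zero n) = 1"
    and gaussian_LCg: "gaussian n \<in> LCg n"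
    and reflect_gaussian: "Rn_reflect n (gaussian n) = gaussian n"
    and Rn_integral_gaussian: "Rn_integral n (gaussian n) = ennreal (sqrt (2 * pi) ^ n)"
  using unit_usc_gauss[of "1/2" n] gauss_zero[of "1/2" n] gauss_LCg[of "1/2" n]
    gauss_reflect[of "1/2" n] Rn_integral_gauss[of "1/2" n]
  by (simp_all add: gaussian_eq_gauss mult.commute)

text \<open>The Gaussian is even, so the reflection disappears, and its square is
  \<open>gauss 1 n\<close>, with integral \<open>sqrt pi ^ n\<close>.\<close>

lemma covering_number_gaussian_le:
  assumes F: "unit_usc n F" and A: "0 \<le> A"
    and le: "Rn_integral n (sup_conv n F (gaussian n)) \<le> ennreal (A ^ n)"
  shows "covering_number n F (gaussian n) \<le> ennreal ((A / sqrt pi) ^ n)"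
proof -
  have "(gaussian n x)\<^sup>2 = gauss 1 n x" for x
    by (simp add: gaussian_def gauss_def power2_eq_square mult_exp_exp)
  then have I: "Rn_integral n (\<lambda>x. (gaussian n x)\<^sup>2) = ennreal (sqrt pi ^ n)"
    using Rn_integral_gauss[of 1 n] by simp
  have "covering_number n F (gaussian n) \<le> Rn_integral n (sup_conv n F (gaussian n)) / ennreal (sqrt pi ^ n)"
    using covering_number_le_integral[OF F unit_usc_gaussian] by (simp add: I reflect_gaussian)
  also have "\<dots> \<le> ennreal (A ^ n) / ennreal (sqrt pi ^ n)"
    using le by (rule divide_right_mono_ennreal)
  also have "\<dots> = ennreal ((A / sqrt pi) ^ n)"
    using A by (simp add: divide_ennreal power_divide)
  finally show ?thesis .
qed

text \<open>In \<open>covering_number_le_integral\<close> the denominator, the integral of the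
  square of \<open>F\<close>, is at least (B/2)^n by halving, and finite because that square is at
  most \<open>F\<close> and so at most its sup-convolution with the Gaussian. The numerator is at
  most A^n after undoing the reflection.\<close>

lemma covering_number_of_gaussian_le:
  assumes F: "unit_usc n F" and A: "0 \<le> A" and B: "0 < B"
    and half: "\<And>x. x \<in> Rn n \<Longrightarrow> F x \<le> (F (Rn_half n x))\<^sup>2"
    and le: "Rn_integral n (sup_conv n F (gaussian n)) \<le> ennreal (A ^ n)"
    and ge: "ennreal (B ^ n) \<le> Rn_integral n F"
  shows "covering_number n (gaussian n) F \<le> ennreal ((2 * A / B) ^ n)"
proof -
  define I where "I = Rn_integral n (\<lambda>x. (F x)\<^sup>2)"
  have "ennreal ((B / 2) ^ n) = ennreal ((1 / 2) ^ n) * ennreal (B ^ n)"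
    using B by (simp add: ennreal_mult[symmetric] power_mult_distrib[symmetric])
  also have "\<dots> \<le> ennreal ((1 / 2) ^ n) * Rn_integral n F"
    using ge by (rule mult_left_mono) simp
  also have "\<dots> \<le> I"
    unfolding I_def by (rule Rn_integral_le_square[OF unit_uscD(4)[OF F] half])
  finally have IB: "ennreal ((B / 2) ^ n) \<le> I" .
  then have I0: "0 < I" using B by (auto intro: less_le_trans[rotated])
  have "(F x)\<^sup>2 \<le> sup_conv n F (gaussian n) x" if x: "x \<in> Rn n" for x
  proof -
    have "(F x)\<^sup>2 \<le> F x * 1"
      unfolding power2_eq_square using unit_uscD(1,2)[OF F x] by (intro mult_left_mono) auto
    then show ?thesis using sup_conv_ge_left[OF F unit_usc_gaussian gaussian_zero x] by simp
  qed
  then have "I \<le> Rn_integral n (sup_conv n F (gaussian n))"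
    unfolding I_def by (rule Rn_integral_mono)
  also note le
  finally have I1: "I < \<infinity>" by (rule le_less_trans) simp
  have "covering_number n (gaussian n) F \<le> Rn_integral n (sup_conv n (gaussian n) (Rn_reflect n F)) / I"
    using covering_number_le_integral[OF unit_usc_gaussian F] I0 I1 by (simp add: I_def)
  also have "Rn_integral n (sup_conv n (gaussian n) (Rn_reflect n F)) = Rn_integral n (sup_conv n F (gaussian n))"
    using Rn_integral_sup_conv_reflect[OF F unit_usc_gaussian] by (simp only: reflect_gaussian)
  also have "\<dots> / I \<le> ennreal ((2 * A / B) ^ n)"
  proof (rule divide_le_posI_ennreal[OF I0])
    have "Rn_integral n (sup_conv n F (gaussian n)) \<le> ennreal ((B / 2) ^ n) * ennreal ((2 * A / B) ^ n)"
      using le A B by (simp add: ennreal_mult[symmetric] power_mult_distrib[symmetric])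
    also have "\<dots> \<le> I * ennreal ((2 * A / B) ^ n)"
      using IB by (rule mult_right_mono) simp
    finally show "Rn_integral n (sup_conv n F (gaussian n)) \<le> I * ennreal ((2 * A / B) ^ n)" .
  qed
  finally show ?thesis .
qed

lemma ennreal_powi_mult_le:
  assumes "0 < D" and "X \<le> ennreal (D ^ n) * Y"
  shows "ennreal (D powi (- int n)) * X \<le> Y"
proof -
  have "ennreal (D powi (- int n)) * X \<le> ennreal (D powi (- int n)) * (ennreal (D ^ n) * Y)"
    using assms(2) by (rule mult_left_mono) simp
  also have "\<dots> = ennreal (D powi (- int n) * D ^ n) * Y"
    using assms(1) by (simp add: ennreal_mult mult.assoc)
  also have "\<dots> = Y" using assms(1) by (simp add: power_int_minus)
  finally show ?thesis .
qed

text \<open>Each covering bound yields one volume inequality: covering by the Gaussian gives the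
  upper ones, covering of the Gaussian the lower ones.\<close>

lemma covering_imp_volume:
  assumes f: "f \<in> LCg n" and cov: "covering_M_position n C f" and C: "0 < C" "C < D" and n: "1 \<le> n"
  shows "volume_M_position n D f"
proof -
  note uf = LCg_unit_usc[OF f] and ug = unit_usc_gaussian[of n]
  have ud: "unit_usc n (dual_fun n f)" using uf f by (intro unit_usc_dual_fun) (auto simp: LCg_def)
  \<comment> \<open>Strictness leaves room for a covering measure near the infimum; it fails in
    dimension 0.\<close>
  have "C ^ n < D ^ n" using C n by (intro power_strict_mono) auto
  then have lt: "ennreal (C ^ n) < ennreal (D ^ n)" using C by (simp add: ennreal_less_iff)
  have le: "Rn_integral n (sup_conv n k h) \<le> ennreal (D ^ n) * Rn_integral n (sup_conv n l h)"
    if "unit_usc n k" "unit_usc n l" "h \<in> LCg n" "covering_number n k l \<le> ennreal (C ^ n)" for k l h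
    using integral_sup_conv_le_covering_number[OF that(1,2) LCg_unit_usc[OF that(3)]
        le_less_trans[OF that(4) lt]] .
  show ?thesis
    unfolding volume_M_position_def
    using cov C le[OF uf ug] le[OF ug uf] le[OF ud ug] le[OF ug ud]
    by (auto simp: covering_M_position_def intro!: ennreal_powi_mult_le)
qed

text \<open>Testing on \<open>gaussian\<close> bounds the numerators, and \<open>int_f\<close>,
  \<open>int_d\<close> bound the integrals below. The resulting constants are 2C for covering
  \<open>f\<close> or its dual, 2 sqrt(2) C for covering the Gaussian by \<open>f\<close>, and 2
  sqrt(2) C^2 for covering it by the dual.\<close>

lemma volume_imp_covering:
  assumes f: "f \<in> LCg n" and vol: "volume_M_position n C f" and C: "0 < C"
    and D: "4 * C \<le> D" "4 * C\<^sup>2 \<le> D"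
  shows "covering_M_position n D f"
proof -
  define d where "d = dual_fun n f"
  \<comment> \<open>The second factor is the n-th root of the integral of
    \<open>gauss (1 / 4) n\<close>.\<close>
  define A where "A = C * sqrt (4 * pi)"
  note uf = LCg_unit_usc[OF f] and ug = unit_usc_gaussian[of n]
  have f0: "f (Rn_zero n) = 1" using f by (simp add: LCg_def)
  have ud: "unit_usc n d" unfolding d_def by (rule unit_usc_dual_fun[OF uf f0])
  have A: "0 \<le> A" using C by (simp add: A_def)
  have "Rn_integral n (sup_conv n (gaussian n) (gaussian n)) \<le> Rn_integral n (gauss (1 / 4) n)"
    using sup_conv_gaussian_le by (intro Rn_integral_mono)
  then have "ennreal (C ^ n) * Rn_integral n (sup_conv n (gaussian n) (gaussian n))
      \<le> ennreal (C ^ n) * ennreal (sqrt (4 * pi) ^ n)"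
    by (intro mult_left_mono) (simp_all add: Rn_integral_gauss mult.commute)
  also have "\<dots> = ennreal (A ^ n)"
    using C by (simp add: A_def ennreal_mult[symmetric] power_mult_distrib)
  finally have AA: "ennreal (C ^ n) * Rn_integral n (sup_conv n (gaussian n) (gaussian n)) \<le> ennreal (A ^ n)" .
  have fA: "Rn_integral n (sup_conv n f (gaussian n)) \<le> ennreal (A ^ n)"
    and dA: "Rn_integral n (sup_conv n d (gaussian n)) \<le> ennreal (A ^ n)"
    using vol gaussian_LCg[of n] AA unfolding volume_M_position_def d_def
    by (blast intro: order_trans)+
  have int_f: "Rn_integral n f = ennreal (sqrt (2 * pi) ^ n)"
    using vol by (simp add: volume_M_position_def powr_half_sqrt[symmetric] powr_powr flip: powr_realpow)
  have int_d: "ennreal ((sqrt (2 * pi) / C) ^ n) \<le> Rn_integral n d"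
  proof (rule Rn_integral_ge_narrow_gauss[OF ud])
    show "Rn_integral n (sup_conv n d (gaussian n)) < \<infinity>" using dA by (auto intro: le_less_trans)
    fix k
    let ?h = "gauss (real (Suc k) / 2) n"
    have h: "?h \<in> LCg n" by (rule gauss_LCg) simp
    have "ennreal ((sqrt (2 * pi) / C) ^ n) = ennreal (C powi (- int n)) * Rn_integral n (gaussian n)"
      using C by (simp add: Rn_integral_gaussian ennreal_mult[symmetric] power_int_minus power_divide field_simps)
    \<comment> \<open>Since \<open>?h\<close> is 1 at the origin, its sup-convolution with the
      Gaussian dominates the Gaussian, so the lower bound is uniform in \<open>k\<close>.\<close>
    also have "\<dots> \<le> ennreal (C powi (- int n)) * Rn_integral n (sup_conv n (gaussian n) ?h)"
      using sup_conv_ge_left[OF ug LCg_unit_usc[OF h] gauss_zero]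
      by (intro mult_left_mono Rn_integral_mono) auto
    also have "\<dots> \<le> Rn_integral n (sup_conv n d ?h)"
      using vol h unfolding volume_M_position_def d_def by blast
    finally show "ennreal ((sqrt (2 * pi) / C) ^ n) \<le> Rn_integral n (sup_conv n d ?h)" .
  qed
  have mono: "N \<le> ennreal (D ^ n)" if "N \<le> ennreal (E ^ n)" "0 \<le> E" "E \<le> D" for N E
    using that(1) by (rule order_trans) (use that in \<open>auto intro!: ennreal_leI power_mono\<close>)
  have s2: "sqrt 2 \<le> 2" by (rule real_le_lsqrt) auto
  have A1: "A / sqrt pi = 2 * C" by (simp add: A_def real_sqrt_mult)
  have "sqrt (4 * pi) = sqrt 2 * sqrt (2 * pi)" by (simp flip: real_sqrt_mult)
  then have "A / sqrt (2 * pi) = C * sqrt 2" by (simp add: A_def)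
  then have A2: "2 * A / sqrt (2 * pi) = 2 * C * sqrt 2" by simp
  have "2 * C * sqrt 2 \<le> 2 * C * 2" using C s2 by (intro mult_left_mono) auto
  then have A2': "2 * A / sqrt (2 * pi) \<le> D" using D by (simp add: A2)
  have A3: "2 * A / (sqrt (2 * pi) / C) = 2 * C\<^sup>2 * sqrt 2"
  proof -
    have "2 * A / (sqrt (2 * pi) / C) = 2 * A / sqrt (2 * pi) * C" by simp
    also have "\<dots> = 2 * C\<^sup>2 * sqrt 2" unfolding A2 by (simp add: power2_eq_square)
    finally show ?thesis .
  qed
  have "2 * C\<^sup>2 * sqrt 2 \<le> 2 * C\<^sup>2 * 2" using C s2 by (intro mult_left_mono) auto
  then have A3': "2 * A / (sqrt (2 * pi) / C) \<le> D" unfolding A3 using D by linarith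
  have A1': "A / sqrt pi \<le> D" using D C by (simp add: A1)
  show ?thesis
    unfolding covering_M_position_def
  proof (intro conjI)
    show "Rn_integral n f = ennreal ((2 * pi) powr (real n / 2))"
      using vol by (simp add: volume_M_position_def)
    show "covering_number n f (gaussian n) \<le> ennreal (D ^ n)"
      by (rule mono[OF covering_number_gaussian_le[OF uf A fA] _ A1']) (use A in simp)
    show "covering_number n (dual_fun n f) (gaussian n) \<le> ennreal (D ^ n)"
      unfolding d_def[symmetric]
      by (rule mono[OF covering_number_gaussian_le[OF ud A dA] _ A1']) (use A in simp)
    show "covering_number n (gaussian n) f \<le> ennreal (D ^ n)"
      using LCg_half[OF f] fA int_f A
      by (intro mono[OF covering_number_of_gaussian_le[OF uf A] _ A2']) auto
    show "covering_number n (gaussian n) (dual_fun n f) \<le> ennreal (D ^ n)"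
      unfolding d_def[symmetric]
      using dual_fun_half[OF uf f0] dA int_d A C
      by (intro mono[OF covering_number_of_gaussian_le[OF ud A] _ A3']) (auto simp: d_def)
  qed
qed

theorem theorem6p8:
  shows "\<forall>C::real. C > 0 \<longrightarrow> (\<exists>C1::real. C1 > 0 \<and>
    (\<forall>n::nat. n \<ge> 1 \<longrightarrow> (\<forall>f\<in>LCg n.
       (covering_M_position n C f \<longrightarrow> volume_M_position n C1 f) \<and>
       (volume_M_position n C f \<longrightarrow> covering_M_position n C1 f))))"
proof (intro allI impI)
  fix C :: real assume C: "C > 0"
  \<comment> \<open>A single constant for both directions: it dominates \<open>4 * C\<close> and
    \<open>4 * C\<^sup>2\<close>, and strictly exceeds \<open>C\<close>.\<close>
  define D where "D = 4 * C + 4 * C\<^sup>2"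
  have D: "0 < D" "C < D" "4 * C \<le> D" "4 * C\<^sup>2 \<le> D"
    using C by (simp_all add: D_def add_pos_pos)
  show "\<exists>C1::real. C1 > 0 \<and>
    (\<forall>n::nat. n \<ge> 1 \<longrightarrow> (\<forall>f\<in>LCg n.
       (covering_M_position n C f \<longrightarrow> volume_M_position n C1 f) \<and>
       (volume_M_position n C f \<longrightarrow> covering_M_position n C1 f)))"
    using C D covering_imp_volume volume_imp_covering by (intro exI[of _ D]) blast
qed

end
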